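(* Let $m\in(0,1)$, let $\mathcal P_m$ be the set of Borel probability measures $P$ on $[0,1]$ with $\mathbb E_P[X_1]\le m$, and for $c\in(0,1)$ let $\mathcal Q_c$ be the set of Borel probability measures $Q$ on $[0,1]$ with $\mathbb E_Q[X_1]>c$. Let $\Lambda\subset(0,1)$ be a countable dense set and $(w_\lambda)_{\lambda\in\Lambda}$ weights with $w_\lambda>0$ and $\sum_{\lambda\in\Lambda}w_\lambda=1$. For $\lambda\in(0,1)$ and $x\in[0,1]$ put $L_\lambda(x)=1+\lambda\left(\frac{x}{m}-1\right)$, and define $$R^{(\lambda)}_n=\sum_{k=1}^n\prod_{i=k}^nL_\lambda(X_i),\quad R_0^{(\lambda)}=0,\qquad M_n=\sum_{\lambda\in\Lambda}w_\lambda R^{(\lambda)}_n,\qquad T^{\mathrm{BM}}_\gamma=\inf\{n\ge1:\ M_n\ge\gamma\}.$$ Then: 1. $\inf_{P\in\mathcal P_m}\mathbb E_{P^\infty}[T^{\mathrm{BM}}_\gamma]\ge\gamma$ for all $\gamma>0$. 2. For every $Q\in\mathcal Q_m$, $$\lim_{\gamma\to\infty}\frac{\mathcal C_Q(T^{\mathrm{BM}}_\gamma)}{\log\gamma}=\frac{1}{\mathrm{KL}_{\inf}(Q;m)}.$$ 3. For every $\Delta\in(0,1-m)$, $$\lim_{\gamma\to\infty}\ \sup_{Q\in\mathcal Q_{m+\Delta}}\ \frac{\mathrm{KL}_{\inf}(Q;m)\,\mathcal C_Q(T^{\mathrm{BM}}_\gamma)}{\log\gamma}=1.$$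
   Context: Observations $X_1,X_2,\dots$ are the coordinate maps on $[0,1]^{\mathbb N}$, with filtration $\mathcal F_n=\sigma(X_1,\dots,X_n)$; $\inf\emptyset=\infty$. For a probability measure $P$, $P^\infty$ is the i.i.d. product measure (no-change law). For $k\ge1$, $P\in\mathcal P_m$ and $Q\in\mathcal Q_m$, $\mathbb P^{(P)}_{k,Q}$ (expectation $\mathbb E^{(P)}_{k,Q}$) is the law under which all $X_i$ are independent, $X_1,\dots,X_{k-1}$ are distributed as $P$, and $X_k,X_{k+1},\dots$ are distributed as $Q$. Pollak's conditional average delay to detection of a stopping time $T$ is $$\mathcal C_Q(T):=\sup_{P\in\mathcal P_m}\ \sup_{k\ge1}\ \mathbb E^{(P)}_{k,Q}\big[(T-k+1)^+\,\big|\,T\ge k\big]\in[0,\infty],$$ where the supremum runs over those $(P,k)$ with $\mathbb P^{(P)}_{k,Q}(T\ge k)>0$. $\mathrm{KL}(Q\|P)$ is the Kullback–Leibler divergence ($+\infty$ if $Q\not\ll P$), and $\mathrm{KL}_{\inf}(Q;m):=\inf_{P\in\mathcal P_m}\mathrm{KL}(Q\|P)$. *)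

theory Defs
  imports "HOL-Probability.Probability"
begin

definition unit_borel :: "real measure" where
  "unit_borel = restrict_space borel {0..1}"

definition unit_probs :: "real measure set" where
  "unit_probs = {P. prob_space P \<and> sets P = sets unit_borel}"

definition pre_laws :: "real \<Rightarrow> real measure set" where
  "pre_laws m = {P \<in> unit_probs. (LINT x|P. x) \<le> m}"

definition post_laws :: "real \<Rightarrow> real measure set" where
  "post_laws c = {Q \<in> unit_probs. (LINT x|Q. x) > c}"

(* Observation paths are functions on the index set {1..}; X_i is the coordinate map
   \<omega> \<mapsto> \<omega> i, i \<ge> 1. *)

definition iid_law :: "real measure \<Rightarrow> (nat \<Rightarrow> real) measure" where
  "iid_law P = (\<Pi>\<^sub>M i\<in>{1..}. P)"

definition change_law :: "nat \<Rightarrow> real measure \<Rightarrow> real measure \<Rightarrow> (nat \<Rightarrow> real) measure" where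
  "change_law k P Q = (\<Pi>\<^sub>M i\<in>{1..}. if i < k then P else Q)"

(* The conditional expectation given the event {T \<ge> k} is the integral with respect to the
   normalised restriction (uniform_measure) of the law to that event.  Subtraction on enat
   is truncated with \<infinity> - k = \<infinity>, so T + 1 - k is (T - k + 1)^+. *)

definition pollak_delay :: "real \<Rightarrow> real measure \<Rightarrow> ((nat \<Rightarrow> real) \<Rightarrow> enat) \<Rightarrow> ennreal" where
  "pollak_delay m Q T =
     (SUP (P, k) \<in> {(P, k). P \<in> pre_laws m \<and> k \<ge> 1 \<and>
          emeasure (change_law k P Q) {\<omega> \<in> space (change_law k P Q). T \<omega> \<ge> enat k} > 0}.
        \<integral>\<^sup>+ \<omega>. ennreal_of_enat (T \<omega> + 1 - enat k)
          \<partial>uniform_measure (change_law k P Q) {\<omega> \<in> space (change_law k P Q). T \<omega> \<ge> enat k})"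

(* KL(Q || P), natural logarithm.  The library's KL_divergence is the Bochner integral of
   ln (dQ/dP) under Q, which defaults to 0 when the integral diverges and is meaningless when
   Q is not absolutely continuous with respect to P.  The negative part of ln (dQ/dP) is always
   Q-integrable for probability measures, so failure of integrability means the value is \<infinity>.
   Otherwise the value is nonnegative, so the embedding into ennreal truncates nothing.
   The library's argument order is KL_divergence b P Q for KL(Q || P), and
   absolutely_continuous P Q means that Q is absolutely continuous w.r.t. P. *)

definition KL :: "real measure \<Rightarrow> real measure \<Rightarrow> ennreal" where
  "KL Q P = (if absolutely_continuous P Q \<and> integrable Q (entropy_density (exp 1) P Q)
             then ennreal (KL_divergence (exp 1) P Q) else \<infinity>)"

definition KL_inf :: "real measure \<Rightarrow> real \<Rightarrow> ennreal" where
  "KL_inf Q m = (INF P \<in> pre_laws m. KL Q P)"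

definition bet :: "real \<Rightarrow> real \<Rightarrow> real \<Rightarrow> real" where
  "bet m l x = 1 + l * (x / m - 1)"

definition sr_stat :: "real \<Rightarrow> real \<Rightarrow> nat \<Rightarrow> (nat \<Rightarrow> real) \<Rightarrow> real" where
  "sr_stat m l n \<omega> = (\<Sum>k=1..n. \<Prod>i=k..n. bet m l (\<omega> i))"

(* For paths in [0,1] and weights summing to 1 the series below converges absolutely,
   since 0 < bet m l x \<le> 1 / m. *)

definition mix_stat :: "real \<Rightarrow> real set \<Rightarrow> (real \<Rightarrow> real) \<Rightarrow> nat \<Rightarrow> (nat \<Rightarrow> real) \<Rightarrow> real" where
  "mix_stat m \<Lambda> w n \<omega> = (\<Sum>\<^sub>\<infinity>l\<in>\<Lambda>. w l * sr_stat m l n \<omega>)"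

definition T_BM :: "real \<Rightarrow> real set \<Rightarrow> (real \<Rightarrow> real) \<Rightarrow> real \<Rightarrow> (nat \<Rightarrow> real) \<Rightarrow> enat" where
  "T_BM m \<Lambda> w \<gamma> \<omega> = Inf {enat n | n. n \<ge> 1 \<and> mix_stat m \<Lambda> w n \<omega> \<ge> \<gamma>}"

end

theory Submission
  imports Defs
begin

text \<open>Write \<open>L\<^sub>l\<close> for the bet with stake \<open>l\<close> and \<open>K\<close> for the value of \<open>KL_inf Q m\<close>.
Convex duality gives \<open>K\<close> as the supremum over \<open>0 < l < 1\<close> of the growth rates \<open>E\<^sub>Q (ln L\<^sub>l)\<close>.

Since \<open>L\<^sub>l\<close> is affine in \<open>l\<close>, the mixture satisfies \<open>M\<^sub>n = (1 + M\<^sub>n\<^sub>-\<^sub>1) L\<^sub>s (X\<^sub>n)\<close> with one predictable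
stake \<open>s\<close>.  Hence \<open>M\<^sub>n - n\<close> is a supermartingale under the pre-change laws (run length), and under \<open>Q\<close>
the process \<open>ln (c + M\<^sub>n)\<close> grows by at most \<open>K + 1/c\<close> per step in expectation (lower bound on the
delay, already for a change at time 1).  No change-of-measure argument is needed.

For the upper bound, after the change \<open>M\<close> dominates \<open>w l\<close> times the product of the bets \<open>L\<^sub>l\<close>, a
random walk in the logarithm, to which Wald's identity applies.  Shrinking a stake from \<open>l\<close> to \<open>k\<close>
costs at most \<open>ln (l / k)\<close> in growth, uniformly in \<open>Q\<close>; so finitely many stakes in \<open>\<Lambda>\<close> are
nearly optimal for all \<open>Q\<close> with mean above \<open>m + \<Delta>\<close>.\<close>

section \<open>Growth rates and information projection\<close>


lemma unit_probsD:
  assumes "P \<in> unit_probs"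
  shows "prob_space P" "sets P = sets unit_borel" "space P = {0..1}"
proof -
  show "prob_space P" and s: "sets P = sets unit_borel"
    using assms by (auto simp: unit_probs_def)
  show "space P = {0..1}"
    using sets_eq_imp_space_eq[OF s] by (simp add: unit_borel_def space_restrict_space)
qed

lemma borel_measurable_unit:
  assumes "P \<in> unit_probs" "f \<in> measurable borel N"
  shows "f \<in> measurable P N"
proof -
  have "f \<in> measurable unit_borel N"
    unfolding unit_borel_def by (rule measurable_restrict_space1[OF assms(2)])
  then show ?thesis
    using measurable_cong_sets[OF unit_probsD(2)[OF assms(1)] refl, of N] by blast
qed

lemma integrable_unit:
  fixes f :: "real \<Rightarrow> real"
  assumes "P \<in> unit_probs" "f \<in> borel_measurable borel" "\<And>x. 0 \<le> x \<Longrightarrow> x \<le> 1 \<Longrightarrow> \<bar>f x\<bar> \<le> C"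
  shows "integrable P f"
proof -
  interpret prob_space P by (rule unit_probsD[OF assms(1)])
  show ?thesis
  proof (rule integrable_const_bound)
    show "AE x in P. norm (f x) \<le> C"
      using assms(3) unit_probsD(3)[OF assms(1)] by (intro AE_I2) auto
  qed (rule borel_measurable_unit[OF assms(1,2)])
qed

lemma AE_unit: "P \<in> unit_probs \<Longrightarrow> (\<And>x. 0 \<le> x \<Longrightarrow> x \<le> 1 \<Longrightarrow> R x) \<Longrightarrow> AE x in P. R x"
  by (rule AE_I2) (auto simp: unit_probsD(3))

lemma integral_mono_unit:
  fixes f g :: "real \<Rightarrow> real"
  assumes "P \<in> unit_probs" "integrable P f" "integrable P g"
    and "\<And>x. 0 \<le> x \<Longrightarrow> x \<le> 1 \<Longrightarrow> f x \<le> g x"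
  shows "integral\<^sup>L P f \<le> integral\<^sup>L P g"
  using assms by (intro integral_mono) (auto simp: unit_probsD(3))

section \<open>Bets and their growth rates\<close>

lemma bet_measurable [measurable]: "bet m l \<in> borel_measurable borel"
  unfolding bet_def by measurable

text \<open>A bet is the convex combination \<open>1 - l + l * (x / m)\<close> of 1 and
  \<open>x / m\<close>, both of which are at most \<open>1 / m\<close>.\<close>

lemma bet_bounds:
  assumes "0 < m" "m < 1" "0 \<le> l" "l < 1" "0 \<le> x" "x \<le> 1"
  shows "1 - l \<le> bet m l x" "0 < bet m l x" "bet m l x \<le> 1 / m"
proof -
  have "0 \<le> l * (x / m)" using assms by simp
  moreover have "bet m l x = 1 - l + l * (x / m)" by (simp add: bet_def algebra_simps)
  ultimately show "1 - l \<le> bet m l x" "0 < bet m l x" using assms by linarith+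
  have "x / m \<le> 1 / m" using assms by (simp add: divide_right_mono)
  moreover have "1 \<le> 1 / m" using assms by simp
  ultimately have "l * (x / m - 1) \<le> l * (1 / m - 1)" "l * (1 / m - 1) \<le> 1 * (1 / m - 1)"
    using assms by (auto intro!: mult_left_mono mult_right_mono)
  then show "bet m l x \<le> 1 / m" by (simp add: bet_def)
qed

text \<open>The Kelly growth rate: expected log-return per observation under \<open>Q\<close> of a
  gambler who always stakes the fraction \<open>l\<close>.\<close>

definition log_growth :: "real \<Rightarrow> real measure \<Rightarrow> real \<Rightarrow> real" where
  "log_growth m Q l = (LINT x|Q. ln (bet m l x))"

lemma ln_bet_bound:
  assumes "0 < m" "m < 1" "0 \<le> l" "l < 1" "0 \<le> x" "x \<le> 1"
  shows "ln (1 - l) \<le> ln (bet m l x)" "ln (bet m l x) \<le> ln (1 / m)"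
    "\<bar>ln (bet m l x)\<bar> \<le> \<bar>ln (1 - l)\<bar> + \<bar>ln (1 / m)\<bar>"
proof -
  note b = bet_bounds[OF assms]
  show "ln (1 - l) \<le> ln (bet m l x)" "ln (bet m l x) \<le> ln (1 / m)"
    using b assms by (auto intro!: ln_mono)
  then show "\<bar>ln (bet m l x)\<bar> \<le> \<bar>ln (1 - l)\<bar> + \<bar>ln (1 / m)\<bar>" by linarith
qed

lemma integrable_ln_bet:
  assumes "Q \<in> unit_probs" "0 < m" "m < 1" "0 \<le> l" "l < 1"
  shows "integrable Q (\<lambda>x. ln (bet m l x))"
  by (rule integrable_unit[OF assms(1), of _ "\<bar>ln (1 - l)\<bar> + \<bar>ln (1 / m)\<bar>"])
     (use ln_bet_bound(3)[OF assms(2-5)] in auto)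

lemma integrable_id_unit: "Q \<in> unit_probs \<Longrightarrow> integrable Q (\<lambda>x. x)"
  by (rule integrable_unit[of _ _ 1]) auto

lemma integral_bet:
  assumes "Q \<in> unit_probs"
  shows "integrable Q (bet m l)" "(LINT x|Q. bet m l x) = bet m l (LINT x|Q. x)"
proof -
  interpret prob_space Q by (rule unit_probsD[OF assms])
  have [simp]: "integrable Q (\<lambda>x. x)" by (rule integrable_id_unit[OF assms])
  show "integrable Q (bet m l)" by (simp add: bet_def[abs_def])
  show "(LINT x|Q. bet m l x) = bet m l (LINT x|Q. x)" by (simp add: bet_def prob_space)
qed

text \<open>Weak duality. The bet has mean at most 1 under \<open>P\<close>, so its ratio to the
  density \<open>g\<close> of \<open>Q\<close> has mean at most 1 under \<open>Q\<close>.
  Integrating \<open>ln t \<le> t - 1\<close> at this ratio compares the two logarithms.\<close>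

lemma log_growth_le_KL:
  assumes m: "0 < m" "m < 1" and P: "P \<in> pre_laws m" and Q: "Q \<in> unit_probs" and l: "0 \<le> l" "l < 1"
  shows "ennreal (log_growth m Q l) \<le> KL Q P"
proof (cases "absolutely_continuous P Q \<and> integrable Q (entropy_density (exp 1) P Q)")
  case False
  then show ?thesis unfolding KL_def by (simp only: if_False) simp
next
  case True
  have Pu: "P \<in> unit_probs" using P by (simp add: pre_laws_def)
  interpret P: prob_space P by (rule unit_probsD[OF Pu])
  interpret Q: prob_space Q by (rule unit_probsD[OF Q])
  have s: "sets Q = sets P" using unit_probsD(2)[OF Pu] unit_probsD(2)[OF Q] by simp
  let ?f = "RN_deriv P Q"
  define g where "g x = enn2real (?f x)" for x
  have gP[measurable]: "g \<in> borel_measurable P" unfolding g_def by measurable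
  then have gQ[measurable]: "g \<in> borel_measurable Q" using measurable_cong_sets[OF s refl] by blast
  have bP[measurable]: "bet m l \<in> borel_measurable P" by (rule borel_measurable_unit[OF Pu]) measurable
  have bQ[measurable]: "bet m l \<in> borel_measurable Q" by (rule borel_measurable_unit[OF Q]) measurable
  have dens: "density P ?f = Q" by (rule P.density_RN_deriv) (use True s in auto)
  have "AE x in P. ?f x \<noteq> \<infinity>"
    by (rule P.RN_deriv_finite) (use True s Q.sigma_finite_measure_axioms in auto)
  then have feq: "AE x in P. ?f x = ennreal (g x)"
    by (auto simp: g_def less_top elim!: eventually_mono)
  have dens': "density P (\<lambda>x. ennreal (g x)) = Q"
    by (subst dens[symmetric], rule density_cong) (use feq in auto)
  \<comment> \<open>\<open>Q\<close> gives no mass to the set where its density vanishes, so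
    dividing by \<open>g\<close> is harmless under \<open>Q\<close>.\<close>
  have "AE x in density P (\<lambda>x. ennreal (g x)). 0 < g x"
    by (subst AE_density) auto
  then have gpos: "AE x in Q. 0 < g x" by (simp only: dens')
  let ?b = "bet m l"
  have bpos: "AE x in Q. 0 < ?b x" by (rule AE_unit[OF Q]) (use bet_bounds m l in auto)
  have "(\<integral>\<^sup>+x. ennreal (?b x / g x) \<partial>Q) = (\<integral>\<^sup>+x. ennreal (g x) * ennreal (?b x / g x) \<partial>P)"
    by (subst dens'[symmetric], subst nn_integral_density) auto
  \<comment> \<open>Only an inequality, since \<open>P\<close> may charge the set where
    \<open>g\<close> is zero; there the left integrand is 0.\<close>
  also have "\<dots> \<le> (\<integral>\<^sup>+x. ennreal (?b x) \<partial>P)"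
  proof (rule nn_integral_mono_AE, rule AE_unit[OF Pu])
    fix x :: real assume "0 \<le> x" "x \<le> 1"
    then have "0 < ?b x" using bet_bounds m l by auto
    then show "ennreal (g x) * ennreal (?b x / g x) \<le> ennreal (?b x)"
      by (cases "g x = 0") (auto simp: ennreal_mult[symmetric] g_def)
  qed
  also have "\<dots> = ennreal (LINT x|P. ?b x)"
    by (rule nn_integral_eq_integral[OF integral_bet(1)[OF Pu]], rule AE_unit[OF Pu])
       (use bet_bounds m l in \<open>auto intro!: less_imp_le\<close>)
  also have "\<dots> \<le> 1"
  proof -
    have "l * ((LINT x|P. x) / m - 1) \<le> 0"
      using P m l by (intro mult_nonneg_nonpos) (auto simp: pre_laws_def)
    then show ?thesis unfolding integral_bet(2)[OF Pu] by (simp add: bet_def)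
  qed
  finally have le1: "(\<integral>\<^sup>+x. ennreal (?b x / g x) \<partial>Q) \<le> 1" .
  have bgnn: "AE x in Q. 0 \<le> ?b x / g x" using bpos gpos by eventually_elim auto
  have int: "integrable Q (\<lambda>x. ?b x / g x)"
    by (rule integrableI_nonneg) (use le1 bgnn in \<open>auto intro: le_less_trans\<close>)
  have "ennreal (LINT x|Q. ?b x / g x) \<le> 1"
    using le1 nn_integral_eq_integral[OF int bgnn] by simp
  then have int1: "(LINT x|Q. ?b x / g x) \<le> 1" by simp
  have ed: "entropy_density (exp 1) P Q = (\<lambda>x. ln (g x))"
    by (auto simp: entropy_density_def g_def log_def)
  have il: "integrable Q (\<lambda>x. ln (g x))" using True by (simp add: ed)
  have "(LINT x|Q. ln (?b x) - ln (g x)) \<le> (LINT x|Q. ?b x / g x - 1)"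
  proof (rule integral_mono_AE)
    show "AE x in Q. ln (?b x) - ln (g x) \<le> ?b x / g x - 1"
      using bpos gpos
    proof eventually_elim
      case (elim x)
      then show ?case using ln_le_minus_one[of "?b x / g x"] by (simp add: ln_div)
    qed
  qed (use il integrable_ln_bet[OF Q m l] int in auto)
  also have "\<dots> \<le> 0" using int1 int by (simp add: Q.prob_space)
  finally have "log_growth m Q l \<le> (LINT x|Q. ln (g x))"
    using il integrable_ln_bet[OF Q m l] by (simp add: log_growth_def)
  then show ?thesis using True by (simp add: KL_def KL_divergence_def ed ennreal_leI)
qed

lemma log_growth_le_KL_inf:
  assumes "0 < m" "m < 1" "Q \<in> unit_probs" "0 \<le> l" "l < 1"
  shows "ennreal (log_growth m Q l) \<le> KL_inf Q m"
  unfolding KL_inf_def by (rule INF_greatest) (use log_growth_le_KL assms in blast)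


text \<open>The witness is \<open>Q\<close> tilted by \<open>s / L\<^sub>l\<close>, with the missing mass \<open>c\<close> put at the point 0, where it
does not increase the mean.  It is realised as the image of a weighted measure on pairs, the second
component telling the tilted part from the atom.\<close>

lemma KL_inf_le_tilt:
  assumes m: "0 < m" "m < 1" and Q: "Q \<in> unit_probs" and l: "0 \<le> l" "l < 1"
    and s: "0 < s" and c: "0 \<le> c"
    and mass: "s * (LINT x|Q. 1 / bet m l x) + c = 1"
    and mean: "s * (LINT x|Q. x / bet m l x) \<le> m"
  shows "KL_inf Q m \<le> ennreal (log_growth m Q l - ln s)"
proof -
  interpret Q: prob_space Q by (rule unit_probsD[OF Q])
  interpret B: sigma_finite_measure "count_space (UNIV :: bool set)"
    by (rule sigma_finite_measure_count_space_finite) simp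
  have sQ [measurable_cong]: "sets Q = sets unit_borel" by (rule unit_probsD(2)[OF Q])
  have id_ub [measurable]: "(\<lambda>x. x) \<in> borel_measurable unit_borel"
    unfolding unit_borel_def by (rule measurable_restrict_space1) simp
  let ?b = "bet m l"
  have bpos: "0 < ?b x" if "0 \<le> x" "x \<le> 1" for x using bet_bounds(2)[OF m l that] .
  have bub [measurable]: "?b \<in> borel_measurable unit_borel"
    unfolding unit_borel_def by (rule measurable_restrict_space1) simp
  define N where "N = Q \<Otimes>\<^sub>M count_space (UNIV :: bool set)"
  define W where "W = (\<lambda>(x :: real, b). if b then ennreal (s / ?b x) else ennreal c)"
  define \<pi> where "\<pi> = (\<lambda>(x :: real, b). if b then x else 0)"
  define P where "P = distr (density N W) unit_borel \<pi>"
  have [measurable]: "W \<in> borel_measurable N" unfolding W_def N_def by measurable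
  have [measurable]: "\<pi> \<in> measurable N unit_borel"
    unfolding unit_borel_def
  proof (rule measurable_restrict_space2)
    show "\<pi> \<in> space N \<rightarrow> {0..1}"
      by (auto simp: \<pi>_def N_def space_pair_measure unit_probsD(3)[OF Q])
    show "\<pi> \<in> borel_measurable N" unfolding \<pi>_def N_def by measurable
  qed
  \<comment> \<open>Every integral against \<open>P\<close> splits into the tilted part and the
    atom; total mass, mean and the density of \<open>Q\<close> are all read off from this.\<close>
  have nnP: "(\<integral>\<^sup>+x. h x \<partial>P) = (\<integral>\<^sup>+x. ennreal (s / ?b x) * h x \<partial>Q) + ennreal c * h 0"
    if h [measurable]: "h \<in> borel_measurable unit_borel" for h
  proof -
    have "(\<integral>\<^sup>+x. h x \<partial>P) = (\<integral>\<^sup>+z. W z * h (\<pi> z) \<partial>N)"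
      unfolding P_def by (subst nn_integral_distr, simp, simp, subst nn_integral_density, simp_all)
    also have "\<dots> = (\<integral>\<^sup>+x. \<integral>\<^sup>+b. W (x, b) * h (\<pi> (x, b)) \<partial>count_space UNIV \<partial>Q)"
      unfolding N_def by (rule B.nn_integral_fst[symmetric]) (simp add: N_def[symmetric])
    also have "\<dots> = (\<integral>\<^sup>+x. ennreal (s / ?b x) * h x + ennreal c * h 0 \<partial>Q)"
      by (subst nn_integral_count_space_finite) (auto simp: UNIV_bool W_def \<pi>_def add.commute)
    also have "\<dots> = (\<integral>\<^sup>+x. ennreal (s / ?b x) * h x \<partial>Q) + ennreal c * h 0"
      by (subst nn_integral_add) (auto simp: Q.emeasure_space_1)
    finally show ?thesis .
  qed
  have le_b: "1 - l \<le> ?b x" if "0 \<le> x" "x \<le> 1" for x using bet_bounds(1)[OF m l that] .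
  have int1: "integrable Q (\<lambda>x. 1 / ?b x)"
  proof (rule integrable_unit[OF Q, where C = "1 / (1 - l)"])
    fix x :: real assume x: "0 \<le> x" "x \<le> 1"
    then show "\<bar>1 / ?b x\<bar> \<le> 1 / (1 - l)" using bpos[OF x] le_b[OF x] l by (auto intro!: divide_left_mono)
  qed measurable
  have intx: "integrable Q (\<lambda>x. x / ?b x)"
  proof (rule integrable_unit[OF Q, where C = "1 / (1 - l)"])
    fix x :: real assume x: "0 \<le> x" "x \<le> 1"
    then show "\<bar>x / ?b x\<bar> \<le> 1 / (1 - l)" using bpos[OF x] le_b[OF x] l by (auto intro!: frac_le)
  qed measurable
  have setsP: "sets P = sets unit_borel" by (simp add: P_def)
  have "emeasure P (space P) = (\<integral>\<^sup>+x. 1 \<partial>P)" by simp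
  also have "\<dots> = (\<integral>\<^sup>+x. ennreal (s * (1 / ?b x)) \<partial>Q) + ennreal c" by (subst nnP) auto
  also have "(\<integral>\<^sup>+x. ennreal (s * (1 / ?b x)) \<partial>Q) = ennreal (s * (LINT x|Q. 1 / ?b x))"
    unfolding integral_mult_right_zero[symmetric]
    by (rule nn_integral_eq_integral[OF integrable_mult_right[OF int1] AE_unit[OF Q]])
       (use s bpos in \<open>simp add: less_imp_le\<close>)
  also have "\<dots> + ennreal c = 1"
  proof -
    have "0 \<le> (LINT x|Q. 1 / ?b x)"
      by (intro integral_nonneg_AE AE_unit[OF Q]) (simp add: bpos less_imp_le)
    then show ?thesis using c s mass by (simp add: ennreal_plus[symmetric] del: ennreal_plus)
  qed
  finally have "prob_space P" by (rule prob_spaceI)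
  then have Pu: "P \<in> unit_probs" by (simp add: unit_probs_def setsP)
  interpret P: prob_space P by fact
  have idP: "(\<lambda>x. x) \<in> borel_measurable P" by (rule borel_measurable_unit[OF Pu]) simp
  have "(LINT x|P. x) = enn2real (\<integral>\<^sup>+x. ennreal x \<partial>P)"
    by (rule integral_eq_nn_integral[OF idP AE_unit[OF Pu]])
  also have "(\<integral>\<^sup>+x. ennreal x \<partial>P) = (\<integral>\<^sup>+x. ennreal (s * (x / ?b x)) \<partial>Q)"
    by (subst nnP) (use s bpos in \<open>auto intro!: nn_integral_cong_AE AE_unit[OF Q] simp: ennreal_mult[symmetric] less_imp_le\<close>)
  also have "\<dots> = ennreal (s * (LINT x|Q. x / ?b x))"
    unfolding integral_mult_right_zero[symmetric]
    by (rule nn_integral_eq_integral[OF integrable_mult_right[OF intx] AE_unit[OF Q]])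
       (use s bpos in \<open>simp add: less_imp_le\<close>)
  finally have "(LINT x|P. x) \<le> m"
    using mean m(1) by (simp add: enn2real_leI)
  then have Pm: "P \<in> pre_laws m" using Pu by (simp add: pre_laws_def)
  \<comment> \<open>The density of \<open>Q\<close> with respect to \<open>P\<close> is
    \<open>?b x / s\<close> off 0. At 0 the tilted part and the atom add up to mass
    \<open>s * q0 / (1 - l) + c\<close>, which gives the quotient \<open>f0\<close>; it is 0 when
    \<open>q0 = 0\<close>, also if the denominator vanishes.\<close>
  define q0 where "q0 = measure Q {0}"
  define f0 where "f0 = q0 / (s * q0 / (1 - l) + c)"
  define f where "f x = (if x = 0 then f0 else ?b x / s)" for x
  have q0: "0 \<le> q0" by (simp add: q0_def)
  have f0nn: "0 \<le> f0" unfolding f0_def using q0 s c l by simp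
  have f0eq: "(s * q0 / (1 - l) + c) * f0 = q0"
  proof (cases "q0 = 0")
    case False
    then have "0 < s * q0 / (1 - l) + c" using q0 s c l by (simp add: add_pos_nonneg)
    then show ?thesis by (simp add: f0_def)
  qed (simp add: f0_def)
  have f_borel [measurable]: "f \<in> borel_measurable borel" unfolding f_def by measurable
  have fub [measurable]: "f \<in> borel_measurable unit_borel"
    unfolding unit_borel_def by (rule measurable_restrict_space1) simp
  have fP [measurable]: "f \<in> borel_measurable P" by (rule borel_measurable_unit[OF Pu]) simp
  have fnn: "0 \<le> f x" if "0 \<le> x" "x \<le> 1" for x using f0nn bpos[OF that] s by (auto simp: f_def)
  have b0: "?b 0 = 1 - l" by (simp add: bet_def)
  have dens: "density P (\<lambda>x. ennreal (f x)) = Q"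
  proof (rule measure_eqI)
    show "sets (density P (\<lambda>x. ennreal (f x))) = sets Q" by (simp add: setsP sQ)
  next
    fix A assume "A \<in> sets (density P (\<lambda>x. ennreal (f x)))"
    then have A [measurable]: "A \<in> sets unit_borel" by (simp add: setsP)
    have z [measurable]: "{0} \<in> sets unit_borel"
      unfolding unit_borel_def by (subst sets_restrict_space_iff) auto
    have AQ [measurable]: "A - {0} \<in> sets Q" using A z by (auto simp: sQ)
    have zQ: "emeasure Q {0} = ennreal q0" by (simp add: q0_def Q.emeasure_eq_measure)
    have "emeasure (density P (\<lambda>x. ennreal (f x))) A = (\<integral>\<^sup>+x. ennreal (f x) * indicator A x \<partial>P)"
      by (rule emeasure_density) (simp_all add: setsP)
    also have "\<dots> = (\<integral>\<^sup>+x. ennreal (s / ?b x) * (ennreal (f x) * indicator A x) \<partial>Q)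
        + ennreal c * (ennreal (f 0) * indicator A 0)"
      by (rule nnP) measurable
    also have "(\<integral>\<^sup>+x. ennreal (s / ?b x) * (ennreal (f x) * indicator A x) \<partial>Q) =
       (\<integral>\<^sup>+x. indicator (A - {0}) x + ennreal (s / (1 - l) * f0) * indicator A 0 * indicator {0} x \<partial>Q)"
    proof (rule nn_integral_cong_AE, rule AE_unit[OF Q])
      fix x :: real assume x: "0 \<le> x" "x \<le> 1"
      show "ennreal (s / ?b x) * (ennreal (f x) * indicator A x) =
          indicator (A - {0}) x + ennreal (s / (1 - l) * f0) * indicator A 0 * indicator {0} x"
        using bpos[OF x] s f0nn l
        by (cases "x = 0") (auto simp: f_def b0 ennreal_mult[symmetric] split: split_indicator)
    qed
    also have "\<dots> = emeasure Q (A - {0}) + ennreal (s / (1 - l) * f0) * indicator A 0 * ennreal q0"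
      using zQ z by (subst nn_integral_add) (auto simp: nn_integral_cmult sQ)
    also have "\<dots> + ennreal c * (ennreal (f 0) * indicator A 0) =
        emeasure Q (A - {0}) + indicator A 0 * ennreal q0"
    proof -
      have "ennreal (s / (1 - l) * f0) * ennreal q0 + ennreal c * ennreal f0 = ennreal q0"
        using f0eq s l f0nn q0 c
        by (simp add: ennreal_mult[symmetric] ennreal_plus[symmetric] algebra_simps del: ennreal_plus)
      then show ?thesis by (auto simp: f_def add.assoc split: split_indicator)
    qed
    also have "\<dots> = emeasure Q A"
    proof (cases "0 \<in> A")
      case True
      have "emeasure Q A = emeasure Q (A - {0} \<union> {0})" using True by (simp add: insert_absorb)
      also have "\<dots> = emeasure Q (A - {0}) + emeasure Q {0}"
        by (rule plus_emeasure[symmetric]) (use AQ z in \<open>auto simp: sQ\<close>)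
      finally show ?thesis using True by (simp add: zQ)
    qed simp
    finally show "emeasure (density P (\<lambda>x. ennreal (f x))) A = emeasure Q A" .
  qed
  have ac: "absolutely_continuous P Q"
    using absolutely_continuousI_density[of "\<lambda>x. ennreal (f x)" P] by (simp add: dens)
  have "AE x in P. ennreal (f x) = RN_deriv P Q x"
    by (rule P.RN_deriv_unique) (simp_all add: dens)
  then have "AE x in Q. ennreal (f x) = RN_deriv P Q x"
    by (rule absolutely_continuous_AE[OF _ ac, rotated]) (simp add: setsP sQ)
  moreover have "AE x in Q. 0 \<le> f x" by (rule AE_unit[OF Q fnn])
  ultimately have edae: "AE x in Q. entropy_density (exp 1) P Q x = ln (f x)"
  proof eventually_elim
    case (elim x)
    then have "enn2real (RN_deriv P Q x) = f x" by (metis enn2real_ennreal)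
    then show ?case by (simp add: entropy_density_def log_def)
  qed
  have intf: "integrable Q (\<lambda>x. ln (f x))"
  proof (rule integrable_unit[OF Q])
    fix x :: real assume x: "0 \<le> x" "x \<le> 1"
    show "\<bar>ln (f x)\<bar> \<le> \<bar>ln f0\<bar> + (\<bar>ln (1 - l)\<bar> + \<bar>ln (1 / m)\<bar> + \<bar>ln s\<bar>)"
      using ln_bet_bound(3)[OF m l x] bpos[OF x] s by (auto simp: f_def ln_div)
  qed measurable
  have [measurable]: "entropy_density (exp 1) P Q \<in> borel_measurable unit_borel"
    using measurable_entropy_density[of "exp 1" P Q] measurable_cong_sets[OF setsP refl] by blast
  have "integrable Q (entropy_density (exp 1) P Q) = integrable Q (\<lambda>x. ln (f x))"
    using edae intf by (intro integrable_cong_AE) (auto simp: measurable_cong_sets[OF sQ refl])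
  then have edint: "integrable Q (entropy_density (exp 1) P Q)" using intf by simp
  have "(LINT x|Q. entropy_density (exp 1) P Q x) = (LINT x|Q. ln (f x))"
    using edae intf edint by (intro integral_cong_AE) auto
  \<comment> \<open>The atom can only lower the density at 0, so \<open>f0 \<le> ?b 0 / s\<close>.
    If \<open>q0 = 0\<close>, then \<open>ln f0\<close> is the default \<open>ln 0 = 0\<close> and
    cannot be compared, but the point 0 is then a null set of \<open>Q\<close>.\<close>
  also have "\<dots> \<le> (LINT x|Q. ln (?b x) - ln s)"
  proof (rule integral_mono_AE[OF intf])
    show "integrable Q (\<lambda>x. ln (?b x) - ln s)" using integrable_ln_bet[OF Q m l] by simp
    have off: "ln (f x) \<le> ln (?b x) - ln s" if "0 \<le> x" "x \<le> 1" "x \<noteq> 0" for x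
      using that bpos[OF that(1,2)] s by (simp add: f_def ln_divide_pos)
    show "AE x in Q. ln (f x) \<le> ln (?b x) - ln s"
    proof (cases "q0 = 0")
      case True
      then have "emeasure Q {0} = 0" by (simp add: q0_def Q.emeasure_eq_measure)
      then have "{0} \<in> null_sets Q"
        by (intro null_setsI) (auto simp: sQ unit_borel_def sets_restrict_space_iff)
      then have "AE x in Q. x \<notin> {0}" by (rule AE_not_in)
      moreover have "AE x in Q. 0 \<le> x \<and> x \<le> 1" by (rule AE_unit[OF Q]) auto
      ultimately show ?thesis by eventually_elim (use off in auto)
    next
      case False
      then have q: "0 < q0" using q0 by simp
      define a where "a = s * q0 / (1 - l)"
      have a: "0 < a" unfolding a_def using q s l by simp
      have f0a: "f0 = q0 / (a + c)" by (simp add: f0_def a_def)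
      have "f0 \<le> q0 / a" unfolding f0a using q a c by (intro divide_left_mono) auto
      also have "\<dots> = (1 - l) / s" using q by (simp add: a_def)
      finally have le: "f0 \<le> (1 - l) / s" .
      have "0 < f0" unfolding f0a using q a c by simp
      then have "ln f0 \<le> ln ((1 - l) / s)" using le s l by (intro ln_mono) auto
      also have "\<dots> = ln (1 - l) - ln s" using s l by (simp add: ln_div)
      finally have "ln f0 \<le> ln (1 - l) - ln s" .
      then show ?thesis using off by (intro AE_unit[OF Q]) (auto simp: f_def b0)
    qed
  qed
  also have "\<dots> = log_growth m Q l - ln s"
    using integrable_ln_bet[OF Q m l] by (simp add: log_growth_def Q.prob_space)
  finally have "KL Q P \<le> ennreal (log_growth m Q l - ln s)"
    using ac edint by (simp add: KL_def KL_divergence_def ennreal_leI)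
  then show ?thesis unfolding KL_inf_def using Pm by (rule INF_lower2[rotated])
qed


text \<open>The reverse half of the duality. Wherever the derivative \<open>d l\<close> of the
  growth rate is nonnegative, a tilt of \<open>Q\<close> attains the growth rate up to the gap
  \<open>ln (1 + (1 - l) * d l)\<close>; the task is to find a stake where this gap is at most
  \<open>e\<close>.\<close>

lemma KL_inf_approx:
  assumes m: "0 < m" "m < 1" and Q: "Q \<in> post_laws m" and e: "0 < e"
  shows "\<exists>l. 0 < l \<and> l < 1 \<and> KL_inf Q m \<le> ennreal (log_growth m Q l + e)"
proof -
  have Qu: "Q \<in> unit_probs" and mean: "m < (LINT x|Q. x)" using Q by (auto simp: post_laws_def)
  interpret Q: prob_space Q by (rule unit_probsD[OF Qu])
  \<comment> \<open>\<open>d\<close> is the derivative of the growth rate: either it vanishes at some stake, or it stays positive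
      and stakes near 1 are nearly optimal.\<close>
  define d where "d l = (LINT x|Q. (x / m - 1) / bet m l x)" for l
  have xm: "\<bar>x / m - 1\<bar> \<le> 1 / m" if "0 \<le> x" "x \<le> 1" for x
  proof -
    have "x / m \<le> 1 / m" "0 \<le> x / m" "1 \<le> 1 / m" using that m by (auto simp: divide_right_mono)
    then show ?thesis by linarith
  qed
  have bnd: "\<bar>(x / m - 1) / bet m l x\<bar> \<le> (1 / m) / (1 - l)"
    if "0 \<le> l" "l < 1" "0 \<le> x" "x \<le> 1" for l x
    using xm[OF that(3,4)] bet_bounds(1,2)[OF m that] that m unfolding abs_divide
    by (intro frac_le) auto
  define h where "h l x = (x / m - 1) / bet m l x" for l x
  have inth: "integrable Q (h l)" if "0 \<le> l" "l < 1" for l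
    unfolding h_def by (rule integrable_unit[OF Qu _ bnd[OF that]]) measurable
  have dh: "d l = (LINT x|Q. h l x)" for l by (simp add: d_def h_def)
  have [measurable]: "h l \<in> borel_measurable borel" for l unfolding h_def by measurable
  \<comment> \<open>Mass and mean of the tilt in terms of \<open>d\<close>, from the pointwise
    identities \<open>1 / L = 1 - l * h\<close> and \<open>x / L = m * (1 + (1 - l) * h)\<close>
    with \<open>L\<close> the bet.\<close>
  have e1: "(LINT x|Q. 1 / bet m l x) = 1 - l * d l"
    and ex: "(LINT x|Q. x / bet m l x) = m * (1 + (1 - l) * d l)" if l: "0 \<le> l" "l < 1" for l
  proof -
    have bh: "bet m l x * h l x = x / m - 1" "bet m l x \<noteq> 0" if "0 \<le> x" "x \<le> 1" for x
      using bet_bounds(2)[OF m l that] by (auto simp: h_def)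
    have "(LINT x|Q. 1 / bet m l x) = (LINT x|Q. 1 - l * h l x)"
    proof (intro integral_cong_AE AE_unit[OF Qu] borel_measurable_unit[OF Qu])
      fix x :: real assume x: "0 \<le> x" "x \<le> 1"
      have "bet m l x * (1 - l * h l x) = bet m l x - l * (bet m l x * h l x)" by (simp add: algebra_simps)
      also have "\<dots> = 1" unfolding bh(1)[OF x] by (simp add: bet_def)
      finally show "1 / bet m l x = 1 - l * h l x" using bh(2)[OF x] by (simp add: field_simps)
    qed measurable
    then show "(LINT x|Q. 1 / bet m l x) = 1 - l * d l"
      using inth[OF l] by (simp add: dh Q.prob_space)
    have "(LINT x|Q. x / bet m l x) = (LINT x|Q. m * (1 + (1 - l) * h l x))"
    proof (intro integral_cong_AE AE_unit[OF Qu] borel_measurable_unit[OF Qu])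
      fix x :: real assume x: "0 \<le> x" "x \<le> 1"
      have "bet m l x * (m * (1 + (1 - l) * h l x)) = m * (bet m l x + (1 - l) * (bet m l x * h l x))"
        by (simp add: algebra_simps)
      also have "\<dots> = x" unfolding bh(1)[OF x] using m by (simp add: bet_def field_simps)
      finally show "x / bet m l x = m * (1 + (1 - l) * h l x)" using bh(2)[OF x] by (simp add: field_simps)
    qed measurable
    then show "(LINT x|Q. x / bet m l x) = m * (1 + (1 - l) * d l)"
      using inth[OF l] by (simp add: dh Q.prob_space)
  qed
  \<comment> \<open>The factor \<open>s = 1 / (1 + (1 - l) * d l)\<close> turns the mean constraint
    into an equality. The mass left for the atom is nonnegative because
    \<open>1 - l * d l \<le> 1 + (1 - l) * d l\<close>.\<close>
  have tilt: "KL_inf Q m \<le> ennreal (log_growth m Q l + ln (1 + (1 - l) * d l))"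
    if l: "0 < l" "l < 1" and d0: "0 \<le> d l" for l
  proof -
    have pos: "0 < 1 + (1 - l) * d l" using l d0 by (simp add: add_pos_nonneg)
    have "KL_inf Q m \<le> ennreal (log_growth m Q l - ln (1 / (1 + (1 - l) * d l)))"
    proof (rule KL_inf_le_tilt[OF m Qu])
      have "1 - l * d l \<le> 1 + (1 - l) * d l" using d0 l by (simp add: algebra_simps)
      then have "1 / (1 + (1 - l) * d l) * (1 - l * d l) \<le> 1" using pos by simp
      then show "0 \<le> 1 - 1 / (1 + (1 - l) * d l) * (1 - l * d l)" by simp
      show "1 / (1 + (1 - l) * d l) * (LINT x|Q. x / bet m l x) \<le> m"
        using pos ex[of l] l by simp
    qed (use l pos e1[of l] in auto)
    then show ?thesis using pos by (simp add: ln_div)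
  qed
  have cont: "continuous_on {0..b} d" if b: "0 \<le> b" "b < 1" for b
  proof -
    \<comment> \<open>A Lipschitz constant valid for all \<open>x\<close> at once: the numerator of
      \<open>h\<close> and its slope in the bet are bounded by \<open>1 / m\<close>, and on
      \<open>{0..b}\<close> both denominators are at least \<open>1 - b\<close>.\<close>
    define C where "C = (1 / m) * (1 / m) / ((1 - b) * (1 - b))"
    have "\<bar>d l - d k\<bar> \<le> C * \<bar>l - k\<bar>" if l: "l \<in> {0..b}" and k: "k \<in> {0..b}" for l k
    proof -
      have il: "0 \<le> l" "l < 1" and ik: "0 \<le> k" "k < 1" using l k b by auto
      have "d l - d k = (LINT x|Q. h l x - h k x)"
        unfolding dh by (rule Bochner_Integration.integral_diff[symmetric, OF inth[OF il] inth[OF ik]])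
      also have "\<bar>\<dots>\<bar> \<le> (LINT x|Q. \<bar>h l x - h k x\<bar>)"
        by (rule integral_abs_bound)
      also have "\<dots> \<le> (LINT x|Q. C * \<bar>l - k\<bar>)"
      proof (rule integral_mono_unit[OF Qu])
        show "integrable Q (\<lambda>x. \<bar>h l x - h k x\<bar>)"
          by (intro integrable_abs Bochner_Integration.integrable_diff inth il ik)
        fix x :: real assume x: "0 \<le> x" "x \<le> 1"
        have pl: "1 - b \<le> bet m l x" "1 - b \<le> bet m k x"
          using bet_bounds(1)[OF m il x] bet_bounds(1)[OF m ik x] l k by auto
        then have p: "0 < bet m l x" "0 < bet m k x" using b by auto
        have frac: "u / v - u / w = u * (w - v) / (v * w)" if "0 < v" "0 < w" for u v w :: real
          using that by (simp add: field_simps)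
        have db: "bet m k x - bet m l x = (x / m - 1) * (k - l)"
        proof -
          have "1 + k * y - (1 + l * y) = y * (k - l)" for y :: real by (simp add: algebra_simps)
          then show ?thesis unfolding bet_def .
        qed
        have "h l x - h k x = (x / m - 1) * ((x / m - 1) * (k - l)) / (bet m l x * bet m k x)"
          unfolding h_def using frac[OF p] by (simp only: db)
        then have "\<bar>h l x - h k x\<bar> =
            \<bar>x / m - 1\<bar> * \<bar>x / m - 1\<bar> / (bet m l x * bet m k x) * \<bar>l - k\<bar>"
          using p by (simp only: abs_mult abs_divide abs_minus_commute[of k] abs_of_pos) simp
        also have "\<dots> \<le> C * \<bar>l - k\<bar>"
          unfolding C_def using m xm[OF x] pl b
          by (intro mult_right_mono frac_le mult_mono mult_pos_pos) auto
        finally show "\<bar>h l x - h k x\<bar> \<le> C * \<bar>l - k\<bar>" .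
      qed simp
      also have "\<dots> = C * \<bar>l - k\<bar>" by (simp add: Q.prob_space)
      finally show ?thesis .
    qed
    then have "C-lipschitz_on {0..b} d"
      using m b by (intro lipschitz_onI) (auto simp: dist_real_def C_def)
    then show ?thesis by (rule lipschitz_on_continuous_on)
  qed
  have "d 0 = (LINT x|Q. x) / m - 1"
    using integrable_id_unit[OF Qu] by (simp add: d_def bet_def Q.prob_space)
  then have d0: "0 < d 0" using mean m by simp
  show ?thesis
  proof (cases "\<exists>b. 0 < b \<and> b < 1 \<and> d b \<le> 0")
    case True
    then obtain b where b: "0 < b" "b < 1" "d b \<le> 0" by blast
    \<comment> \<open>The derivative is positive at stake 0, so it vanishes somewhere in between;
      there the gap is 0.\<close>
    obtain l where l: "0 \<le> l" "l \<le> b" "d l = 0"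
      using IVT2'[of d b 0 0] b d0 cont[of b] by auto
    then have "0 < l" using d0 by (cases "l = 0") auto
    then have "KL_inf Q m \<le> ennreal (log_growth m Q l)" using tilt[of l] l b by simp
    also have "\<dots> \<le> ennreal (log_growth m Q l + e)" using e by (intro ennreal_leI) simp
    finally show ?thesis using \<open>0 < l\<close> l b by (intro exI[of _ l]) auto
  next
    case False
    \<comment> \<open>Since \<open>1 / L\<close> has nonnegative mean,
      \<open>l * d l \<le> 1\<close>. Hence \<open>1 + (1 - l) * d l \<le> 1 / l\<close>, and the
      gap is at most \<open>ln (1 / l) = e\<close>.\<close>
    define l where "l = exp (- e)"
    have l: "0 < l" "l < 1" using e by (auto simp: l_def)
    then have dl: "0 < d l" using False by force
    have "0 \<le> (LINT x|Q. 1 / bet m l x)"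
      by (intro integral_nonneg_AE AE_unit[OF Qu]) (use bet_bounds(2)[OF m, of l] l in \<open>auto simp: less_imp_le\<close>)
    then have "l * d l \<le> 1" using e1[of l] l by simp
    then have "(1 - l) * (l * d l) \<le> (1 - l) * 1" using l by (intro mult_left_mono) auto
    then have "1 + (1 - l) * d l \<le> 1 / l" using l by (simp add: field_simps)
    then have "ln (1 + (1 - l) * d l) \<le> ln (1 / l)"
      using l dl by (intro ln_mono) (auto intro: add_pos_pos)
    also have "\<dots> = e" by (simp add: l_def ln_div)
    finally have "ennreal (log_growth m Q l + ln (1 + (1 - l) * d l)) \<le> ennreal (log_growth m Q l + e)"
      by (intro ennreal_leI) simp
    then show ?thesis using tilt[of l] l dl by (intro exI[of _ l]) auto
  qed
qed

text \<open>The identity \<open>l * bet m k x - k * bet m l x = l - k\<close> shows that the bet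
  with stake \<open>k\<close> is at least \<open>k / l\<close> times the one with stake
  \<open>l\<close>, for every \<open>x\<close>; the cost therefore does not depend on
  \<open>Q\<close>.\<close>

lemma log_growth_ratio:
  assumes m: "0 < m" "m < 1" and Q: "Q \<in> unit_probs" and l: "0 < k" "k \<le> l" "l < 1"
  shows "log_growth m Q l - ln (l / k) \<le> log_growth m Q k"
proof -
  interpret Q: prob_space Q by (rule unit_probsD[OF Q])
  have "log_growth m Q l - ln (l / k) = (LINT x|Q. ln (bet m l x) - ln (l / k))"
    using integrable_ln_bet[OF Q m, of l] l by (simp add: log_growth_def Q.prob_space)
  also have "\<dots> \<le> log_growth m Q k"
    unfolding log_growth_def
  proof (rule integral_mono_unit[OF Q])
    fix x :: real assume x: "0 \<le> x" "x \<le> 1"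
    have p: "0 < bet m l x" "0 < bet m k x" using bet_bounds(2)[OF m _ _ x] l by auto
    have "l * bet m k x - k * bet m l x = l - k" by (simp add: bet_def algebra_simps)
    then have "bet m l x / (l / k) \<le> bet m k x" using l by (simp add: field_simps)
    then have "ln (bet m l x / (l / k)) \<le> ln (bet m k x)" using p l by (intro ln_mono) auto
    moreover have "ln (bet m l x / (l / k)) = ln (bet m l x) - ln (l / k)"
      by (rule ln_divide_pos) (use p l in auto)
    ultimately show "ln (bet m l x) - ln (l / k) \<le> ln (bet m k x)" by simp
  qed (use integrable_ln_bet[OF Q m] l in auto)
  finally show ?thesis .
qed

text \<open>From \<open>ln t \<le> t - 1\<close>. It keeps stakes with a substantial growth rate
  away from 0.\<close>

lemma log_growth_upper:
  assumes m: "0 < m" "m < 1" and Q: "Q \<in> unit_probs" and l: "0 \<le> l" "l < 1"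
  shows "log_growth m Q l \<le> l / m"
proof -
  interpret Q: prob_space Q by (rule unit_probsD[OF Q])
  have "log_growth m Q l \<le> (LINT x|Q. l / m)"
    unfolding log_growth_def
  proof (rule integral_mono_unit[OF Q])
    fix x :: real assume x: "0 \<le> x" "x \<le> 1"
    have "ln (bet m l x) \<le> bet m l x - 1" using bet_bounds(2)[OF m l x] by (rule ln_le_minus_one)
    also have "\<dots> \<le> l * (1 / m)"
      unfolding bet_def using x m l divide_right_mono[of x 1 m] by (simp, intro mult_left_mono[of _ "1/m", simplified]) auto
    finally show "ln (bet m l x) \<le> l / m" by simp
  qed (use integrable_ln_bet[OF Q m l] in auto)
  then show ?thesis by (simp add: Q.prob_space)
qed

text \<open>One small fixed stake serves all laws with this gap. It makes the bet equal to
  \<open>1 + y\<close> with \<open>y = D / 4 * (x - m)\<close>: the linear term has mean above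
  \<open>D\<^sup>2 / 4\<close>, and the quadratic error is at most
  \<open>D\<^sup>2 / 8\<close>.\<close>

lemma log_growth_lower:
  assumes m: "0 < m" "m < 1" and D: "0 < D" "D < 1 - m" and Q: "Q \<in> post_laws (m + D)"
  shows "D\<^sup>2 / 8 \<le> log_growth m Q (m * D / 4)"
proof -
  have Qu: "Q \<in> unit_probs" and mean: "m + D < (LINT x|Q. x)" using Q by (auto simp: post_laws_def)
  interpret Q: prob_space Q by (rule unit_probsD[OF Qu])
  have "m * D \<le> 1 * 1" using m D by (intro mult_mono) auto
  then have l: "0 \<le> m * D / 4" "m * D / 4 < 1" using m D by auto
  have "D\<^sup>2 / 8 = D / 4 * D - D\<^sup>2 / 8" by (simp add: power2_eq_square)
  also have "\<dots> \<le> D / 4 * ((LINT x|Q. x) - m) - D\<^sup>2 / 8" using mean D by simp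
  also have "\<dots> = (LINT x|Q. D / 4 * (x - m) - D\<^sup>2 / 8)"
    using integrable_id_unit[OF Qu] by (simp add: Q.prob_space)
  also have "\<dots> \<le> log_growth m Q (m * D / 4)"
    unfolding log_growth_def
  proof (rule integral_mono_unit[OF Qu _ integrable_ln_bet[OF Qu m l]])
    show "integrable Q (\<lambda>x. D / 4 * (x - m) - D\<^sup>2 / 8)" using integrable_id_unit[OF Qu] by simp
    fix x :: real assume x: "0 \<le> x" "x \<le> 1"
    define y where "y = D / 4 * (x - m)"
    have b: "bet m (m * D / 4) x = 1 + y" using m by (simp add: bet_def y_def field_simps)
    have "\<bar>y\<bar> \<le> D / 4 * 1" unfolding y_def abs_mult using x m D by (intro mult_mono) auto
    then have y: "\<bar>y\<bar> \<le> D / 4" by simp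
    then have "y\<^sup>2 \<le> (D / 4)\<^sup>2" using D by (intro power2_le_iff_abs_le[THEN iffD2]) auto
    then have "2 * y\<^sup>2 \<le> D\<^sup>2 / 8" by (simp add: power2_eq_square)
    moreover have "\<bar>ln (1 + y) - y\<bar> \<le> 2 * y\<^sup>2" using y D m by (intro abs_ln_one_plus_x_minus_x_bound) auto
    ultimately show "D / 4 * (x - m) - D\<^sup>2 / 8 \<le> ln (bet m (m * D / 4) x)"
      unfolding b y_def[symmetric] by linarith
  qed
  finally show ?thesis .
qed

text \<open>Finiteness comes from strong duality with slack 1. The lower bound depends on the gap
  \<open>D\<close> alone, which later turns additive errors into relative ones uniformly in
  \<open>Q\<close>.\<close>

lemma KL_inf_real:
  assumes m: "0 < m" "m < 1" and D: "0 < D" "D < 1 - m" and Q: "Q \<in> post_laws (m + D)"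
  obtains K where "KL_inf Q m = ennreal K" "D\<^sup>2 / 8 \<le> K"
proof -
  have Qu: "Q \<in> unit_probs" and Qm: "Q \<in> post_laws m" using Q D by (auto simp: post_laws_def)
  have "KL_inf Q m \<noteq> \<infinity>" using KL_inf_approx[OF m Qm zero_less_one] by (auto simp: top_unique)
  then obtain K where K: "0 \<le> K" "KL_inf Q m = ennreal K" by (cases "KL_inf Q m") auto
  have "m * D \<le> 1 * 1" using m D by (intro mult_mono) auto
  then have l: "0 \<le> m * D / 4" "m * D / 4 < 1" using m D by auto
  have "ennreal (D\<^sup>2 / 8) \<le> ennreal (log_growth m Q (m * D / 4))"
    by (rule ennreal_leI[OF log_growth_lower[OF m D Q]])
  also have "\<dots> \<le> ennreal K" using log_growth_le_KL_inf[OF m Qu l] K by simp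
  finally have "D\<^sup>2 / 8 \<le> K" using K by simp
  then show thesis using that K by blast
qed

text \<open>Near-optimal stakes lie in \<open>[a, 1)\<close> because small stakes grow too slowly.
  There, moving down to a nearby point of \<open>\<Lambda>\<close> costs little in growth, and
  points of a fine enough grid serve every law.\<close>

lemma log_growth_grid:
  assumes m: "0 < m" "m < 1" and D: "0 < D" "D < 1 - m"
    and dense: "{0<..<1} \<subseteq> closure \<Lambda>" and e: "0 < e"
  shows "\<exists>F. finite F \<and> F \<subseteq> \<Lambda> \<and>
    (\<forall>Q\<in>post_laws (m + D). \<exists>l\<in>F. enn2real (KL_inf Q m) \<le> log_growth m Q l + e)"
proof -
  define \<kappa> where "\<kappa> = D\<^sup>2 / 8"
  define a where "a = m * (\<kappa> / 2)"
  have \<kappa>: "0 < \<kappa>" using D by (simp add: \<kappa>_def)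
  have a: "0 < a" using m \<kappa> by (simp add: a_def)
  \<comment> \<open>The term \<open>4 / a\<close> ensures \<open>2 / N \<le> a / 2\<close>, so the
    shrunken stake stays above \<open>a / 2\<close>; the term \<open>8 / (e * a)\<close> ensures
    that the loss \<open>(2 / N) / (a / 2)\<close> is at most \<open>e / 2\<close>.\<close>
  obtain N :: nat where N: "4 / a + 8 / (e * a) < real N" using reals_Archimedean2 by blast
  have "0 < 4 / a" "0 < 8 / (e * a)" using a e by auto
  then have N0: "0 < real N" and N1: "4 / a < real N" and N2: "8 / (e * a) < real N" using N by linarith+
  have "\<exists>k\<in>\<Lambda>. (real i - 1) / N < k \<and> k < real i / N" if i: "1 \<le> i" "i \<le> N" for i
  proof -
    let ?S = "{(real i - 1) / N<..<real i / N}"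
    have "(real i - 1) / N < (real i - 1/2) / N" "(real i - 1/2) / N < real i / N"
      using N0 by (auto intro!: divide_strict_right_mono)
    then have "(real i - 1/2) / N \<in> ?S" by auto
    moreover have "?S \<subseteq> {0<..<1}"
    proof
      fix x assume x: "x \<in> ?S"
      have "0 \<le> (real i - 1) / N" "real i / N \<le> 1" using i N0 by auto
      then show "x \<in> {0<..<1}" using x by auto
    qed
    ultimately have "?S \<inter> closure \<Lambda> \<noteq> {}" using dense by blast
    then have "?S \<inter> \<Lambda> \<noteq> {}" using open_Int_closure_eq_empty[of ?S \<Lambda>] by auto
    then show ?thesis by auto
  qed
  then obtain p where p: "\<And>i. 1 \<le> i \<Longrightarrow> i \<le> N \<Longrightarrow> p i \<in> \<Lambda> \<and> (real i - 1) / N < p i \<and> p i < real i / N"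
    by metis
  show ?thesis
  proof (intro exI conjI ballI)
    show "finite (p ` {1..N})" "p ` {1..N} \<subseteq> \<Lambda>" using p by auto
    fix Q assume Q: "Q \<in> post_laws (m + D)"
    then have Qu: "Q \<in> unit_probs" and Qm: "Q \<in> post_laws m" using D by (auto simp: post_laws_def)
    obtain K where K: "KL_inf Q m = ennreal K" "\<kappa> \<le> K"
      using KL_inf_real[OF m D Q] unfolding \<kappa>_def by blast
    \<comment> \<open>Half of \<open>e\<close> is reserved for shrinking the stake; the bound
      \<open>\<kappa> / 2\<close> leaves a growth rate of at least \<open>\<kappa> / 2\<close>,
      which forces \<open>a \<le> l\<close>.\<close>
    define e' where "e' = min (e / 2) (\<kappa> / 2)"
    have e': "0 < e'" "e' \<le> e / 2" "e' \<le> \<kappa> / 2" using e \<kappa> by (auto simp: e'_def)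
    obtain l where l: "0 < l" "l < 1" and "KL_inf Q m \<le> ennreal (log_growth m Q l + e')"
      using KL_inf_approx[OF m Qm e'(1)] by blast
    then have Kl: "K \<le> log_growth m Q l + e'"
      using K \<kappa> by (simp add: ennreal_le_iff2)
    have "\<kappa> / 2 \<le> l / m" using Kl K e' log_growth_upper[OF m Qu less_imp_le[OF l(1)] l(2)] by linarith
    then have al: "a \<le> l" using m by (simp add: a_def field_simps)
    \<comment> \<open>The cell used ends at \<open>i / N \<le> l\<close> instead of containing
      \<open>l\<close>, so that its point lies below \<open>l\<close>; the distance is then less
      than \<open>2 / N\<close>.\<close>
    define i where "i = nat \<lfloor>real N * l\<rfloor>"
    have ri: "real i = of_int \<lfloor>real N * l\<rfloor>" using l by (simp add: i_def)
    then have i1: "real i \<le> real N * l" "real N * l < real i + 1" by linarith+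
    have "4 < real N * a" using N1 a by (simp add: field_simps)
    moreover have "real N * a \<le> real N * l" using al by (simp add: mult_left_mono)
    ultimately have i3: "3 < real i" using i1 by linarith
    have "real N * l \<le> real N * 1" using l by (intro mult_left_mono) auto
    then have "real i \<le> real N" using i1 by simp
    then have i: "1 \<le> i" "i \<le> N" using i3 by linarith+
    note pi = p[OF i]
    have "real i / N \<le> l" using i1 N0 by (simp add: field_simps)
    then have pl: "p i \<le> l" using pi by linarith
    have "l < (real i + 1) / N" using i1 N0 by (simp add: field_simps)
    moreover have "(real i + 1) / N = (real i - 1) / N + 2 / N" by (simp add: add_divide_distrib diff_divide_distrib)
    ultimately have diff: "l - p i < 2 / N" using pi by linarith
    have "2 / N \<le> a / 2" using N1 N0 a by (simp add: field_simps)
    then have ap: "a / 2 \<le> p i" using diff al by linarith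
    then have p0: "0 < p i" using a by linarith
    have "ln (l / p i) \<le> l / p i - 1" using p0 l by (intro ln_le_minus_one) auto
    also have "\<dots> = (l - p i) / p i" using p0 by (simp add: field_simps)
    also have "\<dots> \<le> (2 / N) / (a / 2)" using diff pl ap a by (intro frac_le) auto
    also have "\<dots> \<le> e / 2" using N2 N0 a e by (simp add: field_simps)
    finally have "ln (l / p i) \<le> e / 2" .
    then have "K \<le> log_growth m Q (p i) + e"
      using log_growth_ratio[OF m Qu p0 pl l(2)] Kl e' by linarith
    then show "\<exists>l\<in>p ` {1..N}. enn2real (KL_inf Q m) \<le> log_growth m Q l + e"
      using K \<kappa> i by auto
  qed
qed


section \<open>Mixture statistic\<close>

text \<open>Index 0 is excluded because it lies outside the index set of the path laws, where
  extensional functions carry no observation.\<close>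

definition unit_path :: "(nat \<Rightarrow> real) \<Rightarrow> bool" where
  "unit_path \<omega> \<longleftrightarrow> (\<forall>i\<ge>1. 0 \<le> \<omega> i \<and> \<omega> i \<le> 1)"

lemma unit_path_upd: "unit_path \<omega> \<Longrightarrow> 0 \<le> x \<Longrightarrow> x \<le> 1 \<Longrightarrow> unit_path (\<omega> (j := x))"
  by (auto simp: unit_path_def)

lemma sr_stat_0 [simp]: "sr_stat m l 0 \<omega> = 0"
  by (simp add: sr_stat_def)

text \<open>The Shiryaev-Roberts recursion: each earlier starting time gains the newest factor, and
  the starting time \<open>n + 1\<close> contributes that factor alone.\<close>

lemma sr_stat_Suc: "sr_stat m l (Suc n) \<omega> = (1 + sr_stat m l n \<omega>) * bet m l (\<omega> (Suc n))"
proof -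
  have "sr_stat m l (Suc n) \<omega> = (\<Sum>k=1..n. \<Prod>i=k..Suc n. bet m l (\<omega> i)) + bet m l (\<omega> (Suc n))"
    by (simp add: sr_stat_def)
  also have "(\<Sum>k=1..n. \<Prod>i=k..Suc n. bet m l (\<omega> i)) = sr_stat m l n \<omega> * bet m l (\<omega> (Suc n))"
    unfolding sr_stat_def sum_distrib_right by (intro sum.cong refl prod.nat_ivl_Suc') auto
  finally show ?thesis by (simp add: algebra_simps)
qed

lemma sr_stat_upd: "n < j \<Longrightarrow> sr_stat m l n (\<omega> (j := x)) = sr_stat m l n \<omega>"
  unfolding sr_stat_def by (intro sum.cong prod.cong refl) auto

text \<open>Each step of the recursion multiplies by at most \<open>1 / m\<close>. Uniformity in
  \<open>l\<close> lets the weights alone dominate the mixture; uniformity in the path gives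
  integrability.\<close>

lemma sr_stat_bounds:
  assumes m: "0 < m" "m < 1"
  shows "\<exists>B. \<forall>\<omega> l. unit_path \<omega> \<longrightarrow> 0 < l \<longrightarrow> l < 1 \<longrightarrow> 0 \<le> sr_stat m l n \<omega> \<and> sr_stat m l n \<omega> \<le> B"
proof (induction n)
  case (Suc n)
  then obtain B where B: "\<And>\<omega> l. unit_path \<omega> \<Longrightarrow> 0 < l \<Longrightarrow> l < 1 \<Longrightarrow> 0 \<le> sr_stat m l n \<omega> \<and> sr_stat m l n \<omega> \<le> B"
    by blast
  have "0 \<le> sr_stat m l (Suc n) \<omega> \<and> sr_stat m l (Suc n) \<omega> \<le> (1 + B) * (1 / m)"
    if "unit_path \<omega>" "0 < l" "l < 1" for \<omega> l
  proof -
    have "0 \<le> \<omega> (Suc n)" "\<omega> (Suc n) \<le> 1" using that(1) by (auto simp: unit_path_def)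
    note b = bet_bounds(2,3)[OF m less_imp_le[OF that(2)] that(3) this]
    show ?thesis unfolding sr_stat_Suc using B[OF that] b
      by (intro conjI mult_mono mult_nonneg_nonneg) (auto intro: less_imp_le)
  qed
  then show ?case by blast
qed auto

locale bet_mixture =
  fixes m :: real and \<Lambda> :: "real set" and w :: "real \<Rightarrow> real"
  assumes m: "0 < m" "m < 1" and sub: "\<Lambda> \<subseteq> {0<..<1}" and countable: "countable \<Lambda>"
    and wpos: "\<And>l. l \<in> \<Lambda> \<Longrightarrow> w l > 0" and wsum: "(w has_sum 1) \<Lambda>"
begin

abbreviation M :: "nat \<Rightarrow> (nat \<Rightarrow> real) \<Rightarrow> real" where "M \<equiv> mix_stat m \<Lambda> w"

section \<open>Convergence and one-step dynamics of the mixture\<close>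

lemma w_le_1: "l \<in> \<Lambda> \<Longrightarrow> w l \<le> 1"
  using finite_sum_le_has_sum[OF wsum, of "{l}"] wpos[THEN less_imp_le] by simp

lemma summable_weighted:
  assumes "\<And>l. l \<in> \<Lambda> \<Longrightarrow> 0 \<le> g l" "\<And>l. l \<in> \<Lambda> \<Longrightarrow> g l \<le> B"
  shows "(\<lambda>l. w l * g l) summable_on \<Lambda>"
proof (rule summable_on_comparison_test)
  show "(\<lambda>l. w l * B) summable_on \<Lambda>"
    by (rule summable_on_cmult_left) (use wsum in \<open>auto simp: summable_on_def\<close>)
qed (use assms in \<open>auto intro!: mult_left_mono mult_nonneg_nonneg wpos[THEN less_imp_le]\<close>)

lemma sr_nonneg: "unit_path \<omega> \<Longrightarrow> l \<in> \<Lambda> \<Longrightarrow> 0 \<le> sr_stat m l n \<omega>"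
  using sr_stat_bounds[OF m, of n] sub by (meson greaterThanLessThan_iff subsetD)

lemma summable_mix: "unit_path \<omega> \<Longrightarrow> (\<lambda>l. w l * sr_stat m l n \<omega>) summable_on \<Lambda>"
  and summable_stake: "unit_path \<omega> \<Longrightarrow> (\<lambda>l. w l * (l * (1 + sr_stat m l n \<omega>))) summable_on \<Lambda>"
proof -
  assume u: "unit_path \<omega>"
  obtain B where B: "\<And>l. 0 < l \<Longrightarrow> l < 1 \<Longrightarrow> 0 \<le> sr_stat m l n \<omega> \<and> sr_stat m l n \<omega> \<le> B"
    using sr_stat_bounds[OF m, of n] u by blast
  have B': "0 \<le> sr_stat m l n \<omega>" "sr_stat m l n \<omega> \<le> B" "0 < l" "l < 1" if "l \<in> \<Lambda>" for l
    using B sub that by auto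
  show "(\<lambda>l. w l * sr_stat m l n \<omega>) summable_on \<Lambda>"
    by (rule summable_weighted[of _ B]) (use B' in auto)
  show "(\<lambda>l. w l * (l * (1 + sr_stat m l n \<omega>))) summable_on \<Lambda>"
  proof (rule summable_weighted[of _ "1 * (1 + B)"])
    fix l assume "l \<in> \<Lambda>"
    note b = B'[OF this]
    show "0 \<le> l * (1 + sr_stat m l n \<omega>)" using b by simp
    show "l * (1 + sr_stat m l n \<omega>) \<le> 1 * (1 + B)" using b by (intro mult_mono) auto
  qed
qed

text \<open>The part of the capital \<open>1 + M n\<close> wagered on observation
  \<open>n + 1\<close>. It is kept as an amount; dividing by the capital gives the predictable
  fraction.\<close>

definition stake :: "nat \<Rightarrow> (nat \<Rightarrow> real) \<Rightarrow> real" where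
  "stake n \<omega> = (\<Sum>\<^sub>\<infinity>l\<in>\<Lambda>. w l * (l * (1 + sr_stat m l n \<omega>)))"

lemma mix_has_sum: "unit_path \<omega> \<Longrightarrow> ((\<lambda>l. w l * sr_stat m l n \<omega>) has_sum M n \<omega>) \<Lambda>"
  unfolding mix_stat_def using has_sum_infsum[OF summable_mix] .

lemma stake_has_sum: "unit_path \<omega> \<Longrightarrow> ((\<lambda>l. w l * (l * (1 + sr_stat m l n \<omega>))) has_sum stake n \<omega>) \<Lambda>"
  unfolding stake_def using has_sum_infsum[OF summable_stake] .

lemma one_plus_mix_has_sum:
  assumes u: "unit_path \<omega>"
  shows "((\<lambda>l. w l * (1 + sr_stat m l n \<omega>)) has_sum (1 + M n \<omega>)) \<Lambda>"
  using has_sum_add[OF wsum mix_has_sum[OF u, of n]] by (simp add: algebra_simps)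

text \<open>Every summand is affine in the next observation, so summing over
  \<open>\<Lambda>\<close> leaves a single affine function. Both drift bounds rest on this
  form.\<close>

lemma mix_Suc:
  assumes u: "unit_path \<omega>"
  shows "M (Suc n) \<omega> = 1 + M n \<omega> + (\<omega> (Suc n) / m - 1) * stake n \<omega>"
proof -
  let ?c = "\<omega> (Suc n) / m - 1"
  have "((\<lambda>l. w l * (1 + sr_stat m l n \<omega>) + ?c * (w l * (l * (1 + sr_stat m l n \<omega>)))) has_sum
     (1 + M n \<omega> + ?c * stake n \<omega>)) \<Lambda>"
    by (intro has_sum_add one_plus_mix_has_sum has_sum_cmult_right stake_has_sum u)
  moreover have "w l * (1 + sr_stat m l n \<omega>) + ?c * (w l * (l * (1 + sr_stat m l n \<omega>))) =
      w l * sr_stat m l (Suc n) \<omega>" for l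
  proof -
    have "a * r + c * (a * (l * r)) = a * (r * (1 + l * c))" for a r c :: real
      by (simp add: algebra_simps)
    then show ?thesis unfolding sr_stat_Suc bet_def .
  qed
  ultimately have "((\<lambda>l. w l * sr_stat m l (Suc n) \<omega>) has_sum (1 + M n \<omega> + ?c * stake n \<omega>)) \<Lambda>"
    by simp
  then show ?thesis using mix_has_sum[OF u, of "Suc n"] by (rule has_sum_unique[rotated])
qed

lemma mix_0 [simp]: "M 0 \<omega> = 0"
  by (simp add: mix_stat_def)

lemma mix_nonneg: "unit_path \<omega> \<Longrightarrow> 0 \<le> M n \<omega>"
  unfolding mix_stat_def
  by (intro infsum_nonneg mult_nonneg_nonneg sr_nonneg) (auto intro: less_imp_le wpos)

lemma stake_bounds:
  assumes u: "unit_path \<omega>"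
  shows "0 \<le> stake n \<omega>" "stake n \<omega> \<le> 1 + M n \<omega>"
proof -
  have l: "0 < l" "l < 1" if "l \<in> \<Lambda>" for l using sub that by auto
  have s: "0 < 1 + sr_stat m l n \<omega>" if "l \<in> \<Lambda>" for l using sr_nonneg[OF u that, of n] by simp
  show "0 \<le> stake n \<omega>"
    unfolding stake_def
    by (intro infsum_nonneg mult_nonneg_nonneg) (auto intro: less_imp_le wpos l s)
  show "stake n \<omega> \<le> 1 + M n \<omega>"
  proof (rule has_sum_mono[OF stake_has_sum[OF u] one_plus_mix_has_sum[OF u]])
    fix x assume x: "x \<in> \<Lambda>"
    have "x * (1 + sr_stat m x n \<omega>) \<le> 1 * (1 + sr_stat m x n \<omega>)"
      using l[OF x] s[OF x] by (intro mult_right_mono) auto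
    then show "w x * (x * (1 + sr_stat m x n \<omega>)) \<le> w x * (1 + sr_stat m x n \<omega>)"
      using wpos[OF x] by (intro mult_left_mono) auto
  qed
qed

lemma mix_bounded: "\<exists>C. \<forall>\<omega>. unit_path \<omega> \<longrightarrow> M n \<omega> \<le> C"
proof -
  obtain B where B: "\<And>\<omega> l. unit_path \<omega> \<Longrightarrow> 0 < l \<Longrightarrow> l < 1 \<Longrightarrow> 0 \<le> sr_stat m l n \<omega> \<and> sr_stat m l n \<omega> \<le> B"
    using sr_stat_bounds[OF m, of n] by blast
  have "M n \<omega> \<le> 1 * B" if u: "unit_path \<omega>" for \<omega>
  proof (rule has_sum_mono[OF mix_has_sum[OF u] has_sum_cmult_left[OF wsum]])
    fix l assume "l \<in> \<Lambda>"
    then show "w l * sr_stat m l n \<omega> \<le> w l * B"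
      using B[OF u, of l] sub wpos[of l] by (intro mult_left_mono) auto
  qed
  then show ?thesis by blast
qed

lemma mix_upd: "n < j \<Longrightarrow> M n (\<omega> (j := x)) = M n \<omega>"
  by (simp add: mix_stat_def sr_stat_upd)

lemma stake_upd: "n < j \<Longrightarrow> stake n (\<omega> (j := x)) = stake n \<omega>"
  by (simp add: stake_def sr_stat_upd)

text \<open>Keeps one stake and one starting time; all discarded terms are nonnegative. The bound
  ignores everything before \<open>k\<close>, which makes the delay bound uniform in the pre-change
  law.\<close>

lemma prod_le_mix:
  assumes u: "unit_path \<omega>" and l: "l \<in> \<Lambda>" and k: "1 \<le> k" "k \<le> n"
  shows "w l * (\<Prod>i=k..n. bet m l (\<omega> i)) \<le> M n \<omega>"
proof -
  have pos: "0 \<le> bet m l (\<omega> i)" if "1 \<le> i" for i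
    using bet_bounds(2)[OF m, of l "\<omega> i"] sub l u that by (auto simp: unit_path_def intro: less_imp_le)
  have "(\<Prod>i=k..n. bet m l (\<omega> i)) \<le> sr_stat m l n \<omega>"
    unfolding sr_stat_def using k
    by (intro member_le_sum) (auto intro!: prod_nonneg pos)
  then have "w l * (\<Prod>i=k..n. bet m l (\<omega> i)) \<le> w l * sr_stat m l n \<omega>"
    using wpos[OF l] by (intro mult_left_mono) auto
  also have "\<dots> = (\<Sum>l\<in>{l}. w l * sr_stat m l n \<omega>)" by simp
  also have "\<dots> \<le> M n \<omega>"
    by (rule finite_sum_le_has_sum[OF mix_has_sum[OF u]])
       (use l in \<open>auto intro!: mult_nonneg_nonneg less_imp_le[OF wpos] sr_nonneg[OF u]\<close>)
  finally show ?thesis .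
qed

lemma T_BM_ge_iff: "enat j \<le> T_BM m \<Lambda> w \<gamma> \<omega> \<longleftrightarrow> (\<forall>n. 1 \<le> n \<and> n < j \<longrightarrow> M n \<omega> < \<gamma>)"
proof -
  have "enat j \<le> T_BM m \<Lambda> w \<gamma> \<omega> \<longleftrightarrow> (\<forall>n. 1 \<le> n \<and> \<gamma> \<le> M n \<omega> \<longrightarrow> j \<le> n)"
    unfolding T_BM_def le_Inf_iff by auto
  then show ?thesis by (meson not_le)
qed

end

section \<open>Resampling a coordinate\<close>

text \<open>Independent coordinates with arbitrary marginals, so that \<open>iid_law\<close> and
  \<open>change_law\<close> are treated together.\<close>

definition path_laws :: "(nat \<Rightarrow> real measure) set" where
  "path_laws = {D. \<forall>i\<ge>1. D i \<in> unit_probs}"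

lemma path_lawsD: "D \<in> path_laws \<Longrightarrow> 1 \<le> i \<Longrightarrow> D i \<in> unit_probs"
  by (simp add: path_laws_def)

lemma prob_space_path_law: "D \<in> path_laws \<Longrightarrow> prob_space (PiM {1..} D)"
  by (intro prob_space_PiM) (auto dest: path_lawsD unit_probsD)

lemma space_path_law: "D \<in> path_laws \<Longrightarrow> \<omega> \<in> space (PiM {1..} D) \<Longrightarrow> unit_path \<omega>"
proof -
  assume D: "D \<in> path_laws" and w: "\<omega> \<in> space (PiM {1..} D)"
  have "\<omega> i \<in> {0..1}" if i: "1 \<le> i" for i
    using PiE_mem[OF w[unfolded space_PiM], of i] i unit_probsD(3)[OF path_lawsD[OF D i]] by simp
  then show "unit_path \<omega>" by (simp add: unit_path_def)
qed

lemma path_law_upd: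
  assumes "D \<in> path_laws" "\<omega> \<in> space (PiM {1..} D)" "1 \<le> j" "0 \<le> x" "x \<le> 1"
  shows "\<omega> (j := x) \<in> space (PiM {1..} D)"
  using assms by (auto simp: space_PiM PiE_def Pi_def extensional_def unit_probsD(3)[OF path_lawsD])

lemma coordinate_measurable:
  assumes D: "D \<in> path_laws" and i: "1 \<le> i"
  shows "(\<lambda>\<omega>. \<omega> i) \<in> borel_measurable (PiM {1..} D)"
proof -
  have "(\<lambda>\<omega>. \<omega> i) \<in> measurable (PiM {1..} D) (D i)"
    using i by (intro measurable_component_singleton) auto
  then show ?thesis
    by (rule measurable_compose[OF _ borel_measurable_unit[OF path_lawsD[OF D i]]]) simp
qed

text \<open>This replaces conditioning on the past: redrawing \<open>X\<^sub>j\<close> does not change the law, and it does not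
affect events determined by the earlier observations.\<close>

lemma integral_resample_mono:
  fixes F G :: "(nat \<Rightarrow> real) \<Rightarrow> real"
  assumes D: "D \<in> path_laws" and j: "1 \<le> j"
    and F: "integrable (PiM {1..} D) F" and G: "integrable (PiM {1..} D) G"
    and le: "\<And>\<omega>. \<omega> \<in> space (PiM {1..} D) \<Longrightarrow> (LINT x|D j. F (\<omega> (j := x))) \<le> (LINT x|D j. G (\<omega> (j := x)))"
  shows "integral\<^sup>L (PiM {1..} D) F \<le> integral\<^sup>L (PiM {1..} D) G"
proof -
  let ?I = "{1..} - {j}"
  have ins: "insert j ?I = {1..}" using j by auto
  have Dj: "D j \<in> unit_probs" by (rule path_lawsD[OF D j])
  interpret Dj: prob_space "D j" by (rule unit_probsD[OF Dj])
  interpret R: prob_space "PiM ?I D"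
    by (intro prob_space_PiM) (use D in \<open>auto dest: path_lawsD unit_probsD\<close>)
  interpret pair_sigma_finite "D j" "PiM ?I D" ..
  let ?up = "\<lambda>(x, X). X(j := x)"
  \<comment> \<open>The path space factors into coordinate \<open>j\<close> and the rest, so that
    Fubini can integrate over \<open>j\<close> first.\<close>
  have eq: "PiM {1..} D = distr (D j \<Otimes>\<^sub>M PiM ?I D) (PiM {1..} D) ?up"
  proof -
    have "distr (D j \<Otimes>\<^sub>M PiM ?I D) (PiM (insert j ?I) D) ?up = PiM (insert j ?I) D"
      using D j by (intro distr_pair_PiM_eq_PiM) (auto dest: path_lawsD unit_probsD)
    then show ?thesis unfolding ins by (rule sym)
  qed
  have up: "?up \<in> measurable (D j \<Otimes>\<^sub>M PiM ?I D) (PiM {1..} D)"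
  proof -
    have "?up \<in> measurable (D j \<Otimes>\<^sub>M PiM ?I D) (PiM (insert j ?I) D)" by measurable
    then show ?thesis unfolding ins .
  qed
  have *: "integrable (D j \<Otimes>\<^sub>M PiM ?I D) (\<lambda>(x, X). H (X(j := x)))"
    "integral\<^sup>L (PiM {1..} D) H = (LINT X|PiM ?I D. LINT x|D j. H (X(j := x)))"
    if H: "integrable (PiM {1..} D) H" for H :: "(nat \<Rightarrow> real) \<Rightarrow> real"
  proof -
    have "integrable (distr (D j \<Otimes>\<^sub>M PiM ?I D) (PiM {1..} D) ?up) H" using H eq by simp
    then show i: "integrable (D j \<Otimes>\<^sub>M PiM ?I D) (\<lambda>(x, X). H (X(j := x)))"
      by (subst (asm) integrable_distr_eq) (use up H in \<open>auto simp: split_beta'\<close>)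
    have "integral\<^sup>L (PiM {1..} D) H = integral\<^sup>L (distr (D j \<Otimes>\<^sub>M PiM ?I D) (PiM {1..} D) ?up) H"
      using eq by simp
    also have "\<dots> = integral\<^sup>L (D j \<Otimes>\<^sub>M PiM ?I D) (\<lambda>(x, X). H (X(j := x)))"
      by (subst integral_distr[OF up]) (use H in \<open>auto simp: split_beta'\<close>)
    also have "\<dots> = (LINT X|PiM ?I D. LINT x|D j. H (X(j := x)))"
      by (rule integral_snd[OF i, symmetric])
    finally show "integral\<^sup>L (PiM {1..} D) H = (LINT X|PiM ?I D. LINT x|D j. H (X(j := x)))" .
  qed
  have int: "integrable (PiM ?I D) (\<lambda>X. LINT x|D j. H (X(j := x)))"
    if H: "integrable (PiM {1..} D) H" for H :: "(nat \<Rightarrow> real) \<Rightarrow> real"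
    by (rule integrable_snd[OF *(1)[OF H]])
  show ?thesis unfolding *(2)[OF F] *(2)[OF G]
  proof (rule integral_mono[OF int[OF F] int[OF G]])
    fix X assume X: "X \<in> space (PiM ?I D)"
    \<comment> \<open>\<open>X\<close> carries no observation at \<open>j\<close>; the filler 0
      makes it a full path and is overwritten when \<open>j\<close> is redrawn.\<close>
    then have "X(j := 0) \<in> space (PiM {1..} D)"
      using j unit_probsD(3)[OF Dj] by (auto simp: space_PiM PiE_iff extensional_def)
    from le[OF this] show "(LINT x|D j. F (X(j := x))) \<le> (LINT x|D j. G (X(j := x)))"
      by (simp only: fun_upd_upd)
  qed
qed


context bet_mixture
begin

section \<open>Measurability of the statistic and of the alarm time\<close>

lemma sr_stat_measurable:
  assumes D: "D \<in> path_laws"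
  shows "sr_stat m l n \<in> borel_measurable (PiM {1..} D)"
proof (induction n)
  case (Suc n)
  have "(\<lambda>\<omega>. (1 + sr_stat m l n \<omega>) * bet m l (\<omega> (Suc n))) \<in> borel_measurable (PiM {1..} D)"
    by (intro borel_measurable_times borel_measurable_add borel_measurable_const Suc
        measurable_compose[OF coordinate_measurable[OF D] bet_measurable]) simp
  then show ?case by (simp add: sr_stat_Suc[abs_def])
qed (simp add: sr_stat_def[abs_def])

text \<open>Along an enumeration of an infinite \<open>\<Lambda>\<close> the sum is a series of
  measurable functions; the two agree on the path space because the summands are summable on unit
  paths.\<close>

lemma mix_measurable:
  assumes D: "D \<in> path_laws"
  shows "M n \<in> borel_measurable (PiM {1..} D)"
proof (cases "finite \<Lambda>")
  case True
  then have "M n = (\<lambda>\<omega>. \<Sum>l\<in>\<Lambda>. w l * sr_stat m l n \<omega>)"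
    by (auto simp: mix_stat_def)
  then show ?thesis
    by (simp only:) (intro borel_measurable_sum borel_measurable_times borel_measurable_const sr_stat_measurable[OF D])
next
  case False
  let ?g = "from_nat_into \<Lambda>"
  have bij: "bij_betw ?g UNIV \<Lambda>" by (rule bij_betw_from_nat_into[OF countable False])
  have eq: "M n \<omega> = (\<Sum>k. w (?g k) * sr_stat m (?g k) n \<omega>)" if "\<omega> \<in> space (PiM {1..} D)" for \<omega>
  proof -
    have "((\<lambda>l. w l * sr_stat m l n \<omega>) has_sum M n \<omega>) \<Lambda>"
      by (rule mix_has_sum[OF space_path_law[OF D that]])
    then have "((\<lambda>k. w (?g k) * sr_stat m (?g k) n \<omega>) has_sum M n \<omega>) UNIV"
      by (subst has_sum_reindex_bij_betw[OF bij])
    then show ?thesis by (intro sums_unique has_sum_imp_sums)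
  qed
  have "(\<lambda>\<omega>. \<Sum>k. w (?g k) * sr_stat m (?g k) n \<omega>) \<in> borel_measurable (PiM {1..} D)"
    by (intro borel_measurable_suminf borel_measurable_times borel_measurable_const sr_stat_measurable[OF D])
  then show ?thesis by (subst measurable_cong[OF eq])
qed

text \<open>No alarm among the first \<open>j - 1\<close> observations. The index names the
  observation about to be drawn, so the event is predictable.\<close>

definition alive :: "real \<Rightarrow> (nat \<Rightarrow> real measure) \<Rightarrow> nat \<Rightarrow> (nat \<Rightarrow> real) set" where
  "alive \<gamma> D j = {\<omega> \<in> space (PiM {1..} D). enat j \<le> T_BM m \<Lambda> w \<gamma> \<omega>}"

lemma alive_iff:
  "\<omega> \<in> alive \<gamma> D j \<longleftrightarrow> \<omega> \<in> space (PiM {1..} D) \<and> (\<forall>n. 1 \<le> n \<and> n < j \<longrightarrow> M n \<omega> < \<gamma>)"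
  by (simp add: alive_def T_BM_ge_iff)

lemma alive_sets:
  assumes D: "D \<in> path_laws"
  shows "alive \<gamma> D j \<in> sets (PiM {1..} D)"
proof -
  have [measurable]: "M n \<in> borel_measurable (PiM {1..} D)" for n by (rule mix_measurable[OF D])
  have "{\<omega> \<in> space (PiM {1..} D). \<forall>n\<in>{1..<j}. M n \<omega> < \<gamma>} \<in> sets (PiM {1..} D)" by measurable
  moreover have "{\<omega> \<in> space (PiM {1..} D). \<forall>n\<in>{1..<j}. M n \<omega> < \<gamma>} = alive \<gamma> D j"
    by (auto simp: alive_iff)
  ultimately show ?thesis by simp
qed

lemma alive_antimono: "i \<le> j \<Longrightarrow> alive \<gamma> D j \<subseteq> alive \<gamma> D i"
  by (auto simp: alive_iff)

lemma alive_1: "alive \<gamma> D (Suc 0) = space (PiM {1..} D)"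
  by (auto simp: alive_iff)

lemma alive_upd:
  assumes "D \<in> path_laws" "\<omega> \<in> space (PiM {1..} D)" "1 \<le> j" "0 \<le> x" "x \<le> 1"
  shows "\<omega> (j := x) \<in> alive \<gamma> D j \<longleftrightarrow> \<omega> \<in> alive \<gamma> D j"
  using assms path_law_upd[OF assms] by (auto simp: alive_iff mix_upd)

text \<open>Preimages of points suffice: a finite value is a difference of two consecutive survival
  events, and \<infinity> is the intersection of all of them.\<close>

lemma T_BM_measurable:
  assumes D: "D \<in> path_laws"
  shows "T_BM m \<Lambda> w \<gamma> \<in> measurable (PiM {1..} D) (count_space UNIV)"
proof -
  let ?N = "PiM {1..} D"
  have A: "{\<omega> \<in> space ?N. enat j \<le> T_BM m \<Lambda> w \<gamma> \<omega>} \<in> sets ?N" for j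
    using alive_sets[OF D] by (simp add: alive_def)
  show ?thesis
  proof (rule measurable_count_space_eq2_countable[THEN iffD2], intro conjI ballI)
    fix e :: enat
    show "T_BM m \<Lambda> w \<gamma> -` {e} \<inter> space ?N \<in> sets ?N"
    proof (cases e)
      case (enat n)
      have "T_BM m \<Lambda> w \<gamma> -` {e} \<inter> space ?N =
         {\<omega> \<in> space ?N. enat n \<le> T_BM m \<Lambda> w \<gamma> \<omega>} - {\<omega> \<in> space ?N. enat (Suc n) \<le> T_BM m \<Lambda> w \<gamma> \<omega>}"
        using enat by (auto simp: Suc_ile_eq)
      then show ?thesis using A by auto
    next
      case infinity
      have inf: "(t = \<infinity>) = (\<forall>n. enat n \<le> t)" for t :: enat
      proof (cases t)
        case (enat k)
        then have "\<not> enat (Suc k) \<le> t" by simp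
        then show ?thesis using enat by blast
      qed simp
      have "T_BM m \<Lambda> w \<gamma> -` {e} \<inter> space ?N = (\<Inter>n. {\<omega> \<in> space ?N. enat n \<le> T_BM m \<Lambda> w \<gamma> \<omega>})"
      proof (rule set_eqI)
        fix \<omega>
        show "\<omega> \<in> T_BM m \<Lambda> w \<gamma> -` {e} \<inter> space ?N \<longleftrightarrow> \<omega> \<in> (\<Inter>n. {\<omega> \<in> space ?N. enat n \<le> T_BM m \<Lambda> w \<gamma> \<omega>})"
          unfolding infinity using inf[of "T_BM m \<Lambda> w \<gamma> \<omega>"] by auto
      qed
      then show ?thesis using A by auto
    qed
  qed auto
qed

text \<open>The tail-sum formula: \<open>(T - k + 1)^+\<close> exceeds \<open>t\<close> exactly when
  \<open>T \<ge> k + t\<close>, so the term for \<open>t = 0\<close> is the probability of the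
  conditioning event.\<close>

lemma delay_sum:
  assumes D: "D \<in> path_laws"
  shows "(\<integral>\<^sup>+\<omega>. ennreal_of_enat (T_BM m \<Lambda> w \<gamma> \<omega> + 1 - enat k) \<partial>PiM {1..} D) =
    (\<Sum>t. ennreal (measure (PiM {1..} D) (alive \<gamma> D (k + t))))"
proof -
  let ?N = "PiM {1..} D"
  interpret prob_space ?N by (rule prob_space_path_law[OF D])
  have "(\<lambda>\<omega>. T_BM m \<Lambda> w \<gamma> \<omega> + 1 - enat k) \<in> measurable ?N (count_space UNIV)"
    by (rule measurable_compose[OF T_BM_measurable[OF D]]) simp
  then have "(\<integral>\<^sup>+\<omega>. ennreal_of_enat (T_BM m \<Lambda> w \<gamma> \<omega> + 1 - enat k) \<partial>?N) =
    (\<Sum>t. emeasure ?N {\<omega> \<in> space ?N. enat t < T_BM m \<Lambda> w \<gamma> \<omega> + 1 - enat k})"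
    by (rule nn_integral_enat_function)
  moreover have "enat t < x + 1 - enat k \<longleftrightarrow> enat (k + t) \<le> x" for t x
    by (cases x) (simp_all add: one_enat_def, linarith)
  ultimately show ?thesis unfolding alive_def emeasure_eq_measure by simp
qed

section \<open>Stopped drift inequalities\<close>

lemma integrable_path:
  fixes F :: "(nat \<Rightarrow> real) \<Rightarrow> real"
  assumes D: "D \<in> path_laws" and "F \<in> borel_measurable (PiM {1..} D)"
    and "\<And>\<omega>. \<omega> \<in> space (PiM {1..} D) \<Longrightarrow> \<bar>F \<omega>\<bar> \<le> C"
  shows "integrable (PiM {1..} D) F"
proof -
  interpret prob_space "PiM {1..} D" by (rule prob_space_path_law[OF D])
  show ?thesis using assms(2,3) by (intro integrable_const_bound[of _ C] AE_I2) auto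
qed

lemma abs_indicator_times_le: "\<bar>x\<bar> \<le> C \<Longrightarrow> \<bar>indicator A \<omega> * x\<bar> \<le> \<bar>C :: real\<bar>"
  by (auto split: split_indicator)

text \<open>Redrawing observation \<open>j\<close> leaves the indicator unchanged, so it comes out
  of the inner integral. This acts as conditioning on the first \<open>j - 1\<close>
  observations.\<close>

lemma integral_alive_mono:
  fixes F G :: "(nat \<Rightarrow> real) \<Rightarrow> real"
  assumes D: "D \<in> path_laws" and j: "1 \<le> j"
    and F: "F \<in> borel_measurable (PiM {1..} D)" "\<And>\<omega>. \<omega> \<in> space (PiM {1..} D) \<Longrightarrow> \<bar>F \<omega>\<bar> \<le> C"
    and G: "G \<in> borel_measurable (PiM {1..} D)" "\<And>\<omega>. \<omega> \<in> space (PiM {1..} D) \<Longrightarrow> \<bar>G \<omega>\<bar> \<le> C"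
    and le: "\<And>\<omega>. \<omega> \<in> alive \<gamma> D j \<Longrightarrow> (LINT x|D j. F (\<omega> (j := x))) \<le> (LINT x|D j. G (\<omega> (j := x)))"
  shows "(LINT \<omega>|PiM {1..} D. indicator (alive \<gamma> D j) \<omega> * F \<omega>) \<le> (LINT \<omega>|PiM {1..} D. indicator (alive \<gamma> D j) \<omega> * G \<omega>)"
proof (rule integral_resample_mono[OF D j])
  have A [measurable]: "alive \<gamma> D j \<in> sets (PiM {1..} D)" by (rule alive_sets[OF D])
  note [measurable] = F(1) G(1)
  show "integrable (PiM {1..} D) (\<lambda>\<omega>. indicator (alive \<gamma> D j) \<omega> * F \<omega>)"
    by (rule integrable_path[OF D, of _ "\<bar>C\<bar>"], measurable) (use F(2) in \<open>auto intro!: abs_indicator_times_le\<close>)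
  show "integrable (PiM {1..} D) (\<lambda>\<omega>. indicator (alive \<gamma> D j) \<omega> * G \<omega>)"
    by (rule integrable_path[OF D, of _ "\<bar>C\<bar>"], measurable) (use G(2) in \<open>auto intro!: abs_indicator_times_le\<close>)
  fix \<omega> assume w: "\<omega> \<in> space (PiM {1..} D)"
  have ind: "indicator (alive \<gamma> D j) (\<omega> (j := x)) = (indicator (alive \<gamma> D j) \<omega> :: real)"
    if "x \<in> space (D j)" for x
    using that alive_upd[OF D w j] unit_probsD(3)[OF path_lawsD[OF D j]] by (auto split: split_indicator)
  have eq: "(LINT x|D j. indicator (alive \<gamma> D j) (\<omega> (j := x)) * H (\<omega> (j := x))) =
      indicator (alive \<gamma> D j) \<omega> * (LINT x|D j. H (\<omega> (j := x)))" for H :: "(nat \<Rightarrow> real) \<Rightarrow> real"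
  proof -
    have "(LINT x|D j. indicator (alive \<gamma> D j) (\<omega> (j := x)) * H (\<omega> (j := x))) =
       (LINT x|D j. indicator (alive \<gamma> D j) \<omega> * H (\<omega> (j := x)))"
      by (rule Bochner_Integration.integral_cong[OF refl]) (simp add: ind)
    then show ?thesis by simp
  qed
  show "(LINT x|D j. indicator (alive \<gamma> D j) (\<omega> (j := x)) * F (\<omega> (j := x)))
      \<le> (LINT x|D j. indicator (alive \<gamma> D j) (\<omega> (j := x)) * G (\<omega> (j := x)))"
    unfolding eq using le by (auto split: split_indicator)
qed

text \<open>Optional stopping: \<open>g\<close> gains at most \<open>a\<close> per step on average,
  yet at the alarm it has risen from \<open>g 0\<close> to at least \<open>g \<gamma>\<close>.
  Stopping at a finite horizon first keeps every integral finite.\<close>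

lemma drift_bound:
  assumes D: "D \<in> path_laws" and a: "0 < a"
    and g: "g \<in> borel_measurable borel" and mono: "\<And>x y. 0 \<le> x \<Longrightarrow> x \<le> y \<Longrightarrow> g x \<le> g y"
    and drift: "\<And>n \<omega>. \<omega> \<in> space (PiM {1..} D) \<Longrightarrow>
        (LINT x|D (Suc n). g (M (Suc n) (\<omega> (Suc n := x)))) \<le> g (M n \<omega>) + a"
    and \<gamma>: "0 < \<gamma>"
  shows "ennreal (g \<gamma> - g 0) \<le> ennreal a * (\<integral>\<^sup>+\<omega>. ennreal_of_enat (T_BM m \<Lambda> w \<gamma> \<omega>) \<partial>PiM {1..} D)"
proof -
  let ?N = "PiM {1..} D"
  interpret N: prob_space ?N by (rule prob_space_path_law[OF D])
  define V where "V n \<omega> = g (M n \<omega>)" for n \<omega>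
  define A where "A j = alive \<gamma> D j" for j
  define p where "p j = measure ?N (A j)" for j
  have [measurable]: "A j \<in> sets ?N" for j unfolding A_def by (rule alive_sets[OF D])
  have [measurable]: "V n \<in> borel_measurable ?N" for n
    unfolding V_def by (rule measurable_compose[OF mix_measurable[OF D] g])
  have V0: "g 0 \<le> V n \<omega>" if "\<omega> \<in> space ?N" for n \<omega>
    unfolding V_def using mono mix_nonneg[OF space_path_law[OF D that]] by simp
  have "\<exists>C. \<forall>\<omega>\<in>space ?N. \<bar>V n \<omega>\<bar> \<le> C" for n
  proof -
    obtain C where C: "\<And>\<omega>. unit_path \<omega> \<Longrightarrow> M n \<omega> \<le> C" using mix_bounded by blast
    have "\<bar>V n \<omega>\<bar> \<le> \<bar>g 0\<bar> + \<bar>g C\<bar>" if w: "\<omega> \<in> space ?N" for \<omega>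
    proof -
      have "V n \<omega> \<le> g C"
        unfolding V_def using space_path_law[OF D w] mono mix_nonneg C by blast
      then show ?thesis using V0[OF w, of n] by linarith
    qed
    then show ?thesis by blast
  qed
  then obtain C where C: "\<And>n \<omega>. \<omega> \<in> space ?N \<Longrightarrow> \<bar>V n \<omega>\<bar> \<le> C n" by metis
  have intI: "integrable ?N (\<lambda>\<omega>. indicator (A j) \<omega> * V n \<omega>)" for j n
    by (rule integrable_path[OF D, of _ "\<bar>C n\<bar>"], measurable)
       (use C[of _ n] in \<open>auto intro!: abs_indicator_times_le\<close>)
  have step: "(LINT \<omega>|?N. indicator (A (Suc n)) \<omega> * V (Suc n) \<omega> - indicator (A (Suc n)) \<omega> * V n \<omega>) \<le> a * p (Suc n)" for n
  proof -
    have "(LINT \<omega>|?N. indicator (A (Suc n)) \<omega> * V (Suc n) \<omega>) \<le> (LINT \<omega>|?N. indicator (A (Suc n)) \<omega> * (V n \<omega> + a))"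
      unfolding A_def
    proof (rule integral_alive_mono[OF D, where C = "C (Suc n) + C n + a"])
      fix \<omega> assume w: "\<omega> \<in> space ?N"
      have "0 \<le> C n" "0 \<le> C (Suc n)" using C[OF w, of n] C[OF w, of "Suc n"] by linarith+
      then show "\<bar>V (Suc n) \<omega>\<bar> \<le> C (Suc n) + C n + a" "\<bar>V n \<omega> + a\<bar> \<le> C (Suc n) + C n + a"
        using C[OF w, of n] C[OF w, of "Suc n"] a by linarith+
    next
      fix \<omega> assume "\<omega> \<in> alive \<gamma> D (Suc n)"
      then have w: "\<omega> \<in> space ?N" by (simp add: alive_def)
      interpret Dn: prob_space "D (Suc n)" by (rule unit_probsD[OF path_lawsD[OF D]]) simp
      have "(LINT x|D (Suc n). V n (\<omega> (Suc n := x)) + a) = V n \<omega> + a"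
        by (simp add: V_def mix_upd Dn.prob_space)
      then show "(LINT x|D (Suc n). V (Suc n) (\<omega> (Suc n := x))) \<le> (LINT x|D (Suc n). V n (\<omega> (Suc n := x)) + a)"
        using drift[OF w, of n] by (simp add: V_def)
    next
      show "V (Suc n) \<in> borel_measurable ?N" "(\<lambda>\<omega>. V n \<omega> + a) \<in> borel_measurable ?N" by measurable
    qed simp
    also have "\<dots> = (LINT \<omega>|?N. indicator (A (Suc n)) \<omega> * V n \<omega>) + a * p (Suc n)"
      unfolding distrib_left p_def
      by (subst Bochner_Integration.integral_add[OF intI])
         (auto intro!: integrable_mult_left integrable_real_indicator simp: N.emeasure_eq_measure simp del: One_nat_def)
    finally show ?thesis using intI[of "Suc n" n] intI[of "Suc n" "Suc n"] by simp
  qed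
  \<comment> \<open>The increments telescope up to the alarm or to \<open>N\<close>. After an alarm
    the total is at least \<open>g \<gamma> - g 0\<close>; without one it is still nonnegative, as
    \<open>V\<close> never falls below \<open>g 0\<close>.\<close>
  have path: "(g \<gamma> - g 0) * (1 - indicator (A (Suc N)) \<omega>) \<le>
      (\<Sum>n<N. indicator (A (Suc n)) \<omega> * V (Suc n) \<omega> - indicator (A (Suc n)) \<omega> * V n \<omega>)"
    if w: "\<omega> \<in> space ?N" for N \<omega>
  proof (induction N)
    case 0
    then show ?case using w by (simp add: A_def alive_1[unfolded One_nat_def])
  next
    case (Suc N)
    show ?case
    proof (cases "\<omega> \<in> A (Suc N)")
      case True
      then have "\<omega> \<in> A (Suc n)" if "n \<le> N" for n
        using alive_antimono[of "Suc n" "Suc N" \<gamma> D] that by (auto simp: A_def)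
      then have "(\<Sum>n<Suc N. indicator (A (Suc n)) \<omega> * V (Suc n) \<omega> - indicator (A (Suc n)) \<omega> * V n \<omega>) =
         (\<Sum>n<Suc N. V (Suc n) \<omega> - V n \<omega>)"
        by (intro sum.cong) auto
      also have "\<dots> = V (Suc N) \<omega> - g 0" by (subst sum_lessThan_telescope) (simp add: V_def)
      finally have eq: "(\<Sum>n<Suc N. indicator (A (Suc n)) \<omega> * V (Suc n) \<omega> - indicator (A (Suc n)) \<omega> * V n \<omega>) =
         V (Suc N) \<omega> - g 0" .
      show ?thesis
      proof (cases "\<omega> \<in> A (Suc (Suc N))")
        case True
        then show ?thesis unfolding eq using V0[OF w, of "Suc N"] by simp
      next
        case False
        then have "\<gamma> \<le> M (Suc N) \<omega>"
          using True by (auto simp: A_def alive_iff less_Suc_eq not_less)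
        then have "g \<gamma> \<le> V (Suc N) \<omega>" unfolding V_def using \<gamma> mono by simp
        then show ?thesis unfolding eq using False by simp
      qed
    next
      case False
      then have "\<omega> \<notin> A (Suc (Suc N))"
        using alive_antimono[of "Suc N" "Suc (Suc N)" \<gamma> D] by (auto simp: A_def)
      then show ?thesis using Suc False by simp
    qed
  qed
  have main: "(g \<gamma> - g 0) * (1 - p (Suc N)) \<le> a * (\<Sum>n<N. p (Suc n))" for N
  proof -
    have "(g \<gamma> - g 0) * (1 - p (Suc N)) = (LINT \<omega>|?N. (g \<gamma> - g 0) * (1 - indicator (A (Suc N)) \<omega>))"
      unfolding p_def by (subst integral_mult_right_zero, subst Bochner_Integration.integral_diff)
        (auto simp: N.prob_space N.emeasure_eq_measure simp del: One_nat_def intro!: integrable_real_indicator)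
    also have "\<dots> \<le> (LINT \<omega>|?N. (\<Sum>n<N. indicator (A (Suc n)) \<omega> * V (Suc n) \<omega> - indicator (A (Suc n)) \<omega> * V n \<omega>))"
    proof (rule integral_mono)
      show "integrable ?N (\<lambda>\<omega>. (g \<gamma> - g 0) * (1 - indicator (A (Suc N)) \<omega>))"
        by (intro integrable_mult_right Bochner_Integration.integrable_diff integrable_real_indicator)
           (auto simp: N.emeasure_eq_measure simp del: One_nat_def)
    qed (use path intI in auto)
    also have "\<dots> = (\<Sum>n<N. LINT \<omega>|?N. indicator (A (Suc n)) \<omega> * V (Suc n) \<omega> - indicator (A (Suc n)) \<omega> * V n \<omega>)"
      by (rule Bochner_Integration.integral_sum) (use intI in auto)
    also have "\<dots> \<le> (\<Sum>n<N. a * p (Suc n))" by (intro sum_mono step)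
    finally show ?thesis by (simp add: sum_distrib_left)
  qed
  have ET: "(\<integral>\<^sup>+\<omega>. ennreal_of_enat (T_BM m \<Lambda> w \<gamma> \<omega>) \<partial>?N) = (\<Sum>n. ennreal (p (Suc n)))"
  proof -
    have one: "t + 1 - enat 1 = t" for t :: enat by (cases t) (auto simp: one_enat_def)
    show ?thesis using delay_sum[OF D, of \<gamma> 1] unfolding one by (simp add: p_def A_def)
  qed
  have p0: "0 \<le> p n" for n by (simp add: p_def)
  \<comment> \<open>If the expected alarm time is infinite, the right side is infinite because
    \<open>a\<close> is positive. Otherwise the survival probabilities are summable, hence tend to
    0, and \<open>main\<close> passes to the limit.\<close>
  show ?thesis
  proof (cases "(\<Sum>n. ennreal (p (Suc n))) = \<infinity>")
    case True
    then show ?thesis unfolding ET using a by (simp add: ennreal_mult_top)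
  next
    case False
    then have summ: "summable (\<lambda>n. p (Suc n))"
      by (intro summable_suminf_not_top) (use p0 in auto)
    have "(\<lambda>N. (g \<gamma> - g 0) * (1 - p (Suc N))) \<longlonglongrightarrow> (g \<gamma> - g 0) * (1 - 0)"
      by (intro tendsto_intros summable_LIMSEQ_zero summ)
    moreover have "(\<lambda>N. a * (\<Sum>n<N. p (Suc n))) \<longlonglongrightarrow> a * (\<Sum>n. p (Suc n))"
      by (intro tendsto_intros summable_LIMSEQ summ)
    ultimately have "(g \<gamma> - g 0) * (1 - 0) \<le> a * (\<Sum>n. p (Suc n))"
      by (rule LIMSEQ_le) (use main in blast)
    then have "ennreal (g \<gamma> - g 0) \<le> ennreal (a * (\<Sum>n. p (Suc n)))" by (intro ennreal_leI) simp
    also have "\<dots> = ennreal a * (\<Sum>n. ennreal (p (Suc n)))"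
      using a p0 summ by (simp add: ennreal_mult suminf_ennreal2 suminf_nonneg)
    finally show ?thesis unfolding ET .
  qed
qed


section \<open>Run length and detection delay\<close>

lemma mix_Suc_upd:
  assumes D: "D \<in> path_laws" and w: "\<omega> \<in> space (PiM {1..} D)" and x: "0 \<le> x" "x \<le> 1"
  shows "M (Suc n) (\<omega> (Suc n := x)) = 1 + M n \<omega> + (x / m - 1) * stake n \<omega>"
  using mix_Suc[OF unit_path_upd[OF space_path_law[OF D w] x], of n "Suc n"]
  by (simp add: mix_upd stake_upd)

text \<open>The amount wagered is nonnegative and \<open>x / m - 1\<close> has nonpositive mean
  under \<open>P\<close>, so \<open>M\<close> drifts up by at most 1 per step, and
  \<open>drift_bound\<close> applies with \<open>g\<close> the identity.\<close>

lemma run_length_bound: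
  assumes P: "P \<in> pre_laws m" and \<gamma>: "0 < \<gamma>"
  shows "ennreal \<gamma> \<le> (\<integral>\<^sup>+\<omega>. ennreal_of_enat (T_BM m \<Lambda> w \<gamma> \<omega>) \<partial>iid_law P)"
proof -
  have Pu: "P \<in> unit_probs" and mean: "(LINT x|P. x) \<le> m" using P by (auto simp: pre_laws_def)
  interpret P: prob_space P by (rule unit_probsD[OF Pu])
  define D where "D = (\<lambda>_ :: nat. P)"
  have D: "D \<in> path_laws" using Pu by (simp add: D_def path_laws_def)
  have "ennreal (\<gamma> - 0) \<le> ennreal 1 * (\<integral>\<^sup>+\<omega>. ennreal_of_enat (T_BM m \<Lambda> w \<gamma> \<omega>) \<partial>PiM {1..} D)"
  proof (rule drift_bound[OF D, where g = "\<lambda>x. x"])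
    fix n \<omega> assume w: "\<omega> \<in> space (PiM {1..} D)"
    have "(LINT x|P. M (Suc n) (\<omega> (Suc n := x))) = (LINT x|P. 1 + M n \<omega> + (x / m - 1) * stake n \<omega>)"
      by (rule Bochner_Integration.integral_cong[OF refl])
         (use mix_Suc_upd[OF D w] in \<open>simp add: unit_probsD(3)[OF Pu]\<close>)
    also have "\<dots> = 1 + M n \<omega> + ((LINT x|P. x) / m - 1) * stake n \<omega>"
      using integrable_id_unit[OF Pu] by (simp add: P.prob_space)
    also have "\<dots> \<le> 1 + M n \<omega>"
      using mean m stake_bounds(1)[OF space_path_law[OF D w], of n] by (simp add: mult_nonpos_nonneg)
    finally show "(LINT x|D (Suc n). M (Suc n) (\<omega> (Suc n := x))) \<le> M n \<omega> + 1"
      by (simp add: D_def)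
  qed (use \<gamma> in auto)
  then show ?thesis by (simp add: iid_law_def D_def)
qed

text \<open>With \<open>s = c + 1 + M n\<close> the new value of \<open>c + M\<close> is
  \<open>s\<close> times a bet of stake \<open>stake n \<omega> / s\<close>, which \<open>c\<close>
  keeps strictly below 1. Weak duality bounds the growth of this bet by \<open>K\<close>; the added
  unit costs \<open>ln (s / (s - 1)) \<le> 1 / c\<close>.\<close>

lemma log_stat_drift:
  assumes D: "D \<in> path_laws" and DQ: "D (Suc n) = Q" and w: "\<omega> \<in> space (PiM {1..} D)"
    and K: "KL_inf Q m = ennreal K" "0 \<le> K" and c: "0 < c"
  shows "(LINT x|Q. ln (c + M (Suc n) (\<omega> (Suc n := x)))) \<le> ln (c + M n \<omega>) + (K + 1 / c)"
proof -
  have Q: "Q \<in> unit_probs" using path_lawsD[OF D, of "Suc n"] DQ by simp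
  interpret Q: prob_space Q by (rule unit_probsD[OF Q])
  have u: "unit_path \<omega>" by (rule space_path_law[OF D w])
  note st = stake_bounds[OF u, of n]
  have M0: "0 \<le> M n \<omega>" by (rule mix_nonneg[OF u])
  define s where "s = c + 1 + M n \<omega>"
  define l where "l = stake n \<omega> / s"
  have s: "0 < s" using M0 c by (simp add: s_def)
  have l: "0 \<le> l" "l < 1" using st s c by (auto simp: l_def s_def)
  have sl: "s * l = stake n \<omega>" using s by (simp add: l_def)
  have "(LINT x|Q. ln (c + M (Suc n) (\<omega> (Suc n := x)))) = (LINT x|Q. ln s + ln (bet m l x))"
  proof (rule Bochner_Integration.integral_cong[OF refl])
    fix x assume "x \<in> space Q"
    then have x: "0 \<le> x" "x \<le> 1" by (auto simp: unit_probsD(3)[OF Q])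
    have "c + M (Suc n) (\<omega> (Suc n := x)) = s + (x / m - 1) * (s * l)"
      unfolding mix_Suc_upd[OF D w x] sl by (simp add: s_def)
    also have "\<dots> = s * bet m l x" by (simp add: bet_def algebra_simps)
    finally show "ln (c + M (Suc n) (\<omega> (Suc n := x))) = ln s + ln (bet m l x)"
      using s bet_bounds(2)[OF m l x] by (simp add: ln_mult_pos)
  qed
  also have "\<dots> = ln s + log_growth m Q l"
    using integrable_ln_bet[OF Q m l] by (simp add: log_growth_def Q.prob_space)
  also have "log_growth m Q l \<le> K"
    using log_growth_le_KL_inf[OF m Q l] K by (simp add: ennreal_le_iff)
  also have "ln s \<le> ln (c + M n \<omega>) + 1 / c"
  proof -
    have p: "0 < c + M n \<omega>" using c M0 by simp
    have "ln s - ln (c + M n \<omega>) = ln (s / (c + M n \<omega>))" using s p by (simp add: ln_divide_pos)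
    also have "\<dots> \<le> s / (c + M n \<omega>) - 1" using s p by (intro ln_le_minus_one) simp
    also have "\<dots> = 1 / (c + M n \<omega>)" using p by (simp add: s_def field_simps)
    also have "\<dots> \<le> 1 / c" using c M0 by (intro divide_left_mono) auto
    finally show ?thesis by simp
  qed
  finally show ?thesis by simp
qed

text \<open>This is \<open>drift_bound\<close> with \<open>g x = ln (c + x)\<close>. A large
  \<open>c\<close> brings the rate close to \<open>K\<close> at the price of the constant
  \<open>ln c\<close>, negligible as \<gamma> grows.\<close>

lemma iid_delay_lower:
  assumes Q: "Q \<in> unit_probs" and K: "KL_inf Q m = ennreal K" "0 \<le> K" and c: "0 < c" and \<gamma>: "0 < \<gamma>"
  shows "ennreal (ln (c + \<gamma>) - ln c) \<le>
    ennreal (K + 1 / c) * (\<integral>\<^sup>+\<omega>. ennreal_of_enat (T_BM m \<Lambda> w \<gamma> \<omega>) \<partial>iid_law Q)"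
proof -
  define D where "D = (\<lambda>_ :: nat. Q)"
  have D: "D \<in> path_laws" using Q by (simp add: D_def path_laws_def)
  have "ennreal (ln (c + \<gamma>) - ln (c + 0)) \<le>
    ennreal (K + 1 / c) * (\<integral>\<^sup>+\<omega>. ennreal_of_enat (T_BM m \<Lambda> w \<gamma> \<omega>) \<partial>PiM {1..} D)"
  proof (rule drift_bound[OF D, where g = "\<lambda>x. ln (c + x)"])
    show "0 < K + 1 / c" using K c by (simp add: add_nonneg_pos)
    fix n \<omega> assume w: "\<omega> \<in> space (PiM {1..} D)"
    show "(LINT x|D (Suc n). ln (c + M (Suc n) (\<omega> (Suc n := x)))) \<le> ln (c + M n \<omega>) + (K + 1 / c)"
      using log_stat_drift[OF D _ w K c, of n] by (simp add: D_def)
  qed (use c \<gamma> in auto)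
  then show ?thesis by (simp add: iid_law_def D_def)
qed

end

text \<open>Point masses supply explicit members of the pre-change and post-change classes.\<close>

lemma return_unit:
  assumes "0 \<le> a" "a \<le> 1"
  shows "return unit_borel a \<in> unit_probs" "(LINT x|return unit_borel a. x) = a"
proof -
  have a: "a \<in> space unit_borel" using assms by (simp add: unit_borel_def space_restrict_space)
  show "return unit_borel a \<in> unit_probs"
    using prob_space_return[OF a] by (simp add: unit_probs_def)
  have "(\<lambda>x. x) \<in> borel_measurable unit_borel"
    unfolding unit_borel_def by (rule measurable_restrict_space1) simp
  then show "(LINT x|return unit_borel a. x) = a" by (rule integral_return[OF a])
qed

context bet_mixture
begin

text \<open>For a change at time 1 the pre-change law governs no observation, so the point mass at 0
  serves; the conditioning event \<open>T \<ge> 1\<close> is the whole space, and the delay is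
  \<open>T\<close> itself.\<close>

lemma iid_delay_le_pollak:
  assumes Q: "Q \<in> unit_probs"
  shows "(\<integral>\<^sup>+\<omega>. ennreal_of_enat (T_BM m \<Lambda> w \<gamma> \<omega>) \<partial>iid_law Q) \<le> pollak_delay m Q (T_BM m \<Lambda> w \<gamma>)"
proof -
  let ?P = "return unit_borel 0" and ?T = "T_BM m \<Lambda> w \<gamma>"
  define N where "N = iid_law Q"
  have P: "?P \<in> pre_laws m" using return_unit[of 0] m by (simp add: pre_laws_def)
  have N: "change_law 1 ?P Q = N"
    unfolding change_law_def iid_law_def N_def by (rule PiM_cong) auto
  define D where "D = (\<lambda>_ :: nat. Q)"
  have D: "D \<in> path_laws" using Q by (simp add: D_def path_laws_def)
  have ND: "N = PiM {1..} D" by (simp add: N_def iid_law_def D_def)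
  interpret N: prob_space N unfolding ND by (rule prob_space_path_law[OF D])
  have S: "{\<omega> \<in> space N. ?T \<omega> \<ge> enat 1} = space N" by (auto simp: T_BM_ge_iff)
  have one: "t + 1 - enat 1 = t" for t :: enat by (cases t) (auto simp: one_enat_def)
  have meas: "(\<lambda>\<omega>. ennreal_of_enat (?T \<omega>)) \<in> borel_measurable N"
    unfolding ND by (rule measurable_compose[OF T_BM_measurable[OF D]]) simp
  have "(\<integral>\<^sup>+\<omega>. ennreal_of_enat (?T \<omega> + 1 - enat 1) \<partial>uniform_measure N (space N)) =
      (\<integral>\<^sup>+\<omega>. ennreal_of_enat (?T \<omega>) \<partial>N)"
    unfolding one
    by (subst nn_integral_uniform_measure[OF meas])
       (auto simp: N.emeasure_space_1 divide_ennreal_def intro!: nn_integral_cong)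
  moreover have "(?P, 1) \<in> {(P, k). P \<in> pre_laws m \<and> k \<ge> 1 \<and>
          emeasure (change_law k P Q) {\<omega> \<in> space (change_law k P Q). ?T \<omega> \<ge> enat k} > 0}"
    using P by (simp only: mem_Collect_eq case_prod_conv N S N.emeasure_space_1) simp
  ultimately show ?thesis
    unfolding pollak_delay_def
    by (intro SUP_upper2[where i = "(?P, 1)"]) (simp_all only: case_prod_conv N S N_def[symmetric] order_refl)
qed

text \<open>A stopped Wald identity. From \<open>k\<close> on, each step before the alarm adds
  \<open>log_growth m Q l\<close> on average to the log of the product of bets. That log is at most
  \<open>ln (\<gamma> / w l)\<close> before the alarm and overshoots by at most
  \<open>ln (1 / m)\<close>. Truncated subtraction makes the delay vanish off the conditioning
  event.\<close>

lemma conditional_delay_upper: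
  assumes D: "D \<in> path_laws" and k: "1 \<le> k" and DQ: "\<And>i. k \<le> i \<Longrightarrow> D i = Q"
    and l: "l \<in> \<Lambda>" and pos: "0 < log_growth m Q l" and \<gamma>: "1 \<le> \<gamma>"
  shows "(\<integral>\<^sup>+\<omega>. ennreal_of_enat (T_BM m \<Lambda> w \<gamma> \<omega> + 1 - enat k) \<partial>PiM {1..} D)
    \<le> ennreal ((ln (\<gamma> / w l) + ln (1 / m)) / log_growth m Q l) * emeasure (PiM {1..} D) (alive \<gamma> D k)"
proof -
  let ?N = "PiM {1..} D"
  interpret N: prob_space ?N by (rule prob_space_path_law[OF D])
  have l01: "0 \<le> l" "l < 1" using l sub by auto
  have Q: "Q \<in> unit_probs" using path_lawsD[OF D k] DQ[of k] by simp
  interpret Q: prob_space Q by (rule unit_probsD[OF Q])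
  define b where "b = log_growth m Q l"
  have b: "0 < b" using pos by (simp add: b_def)
  define A where "A i = alive \<gamma> D (k + i)" for i
  define Y where "Y i \<omega> = ln (bet m l (\<omega> (k + i)))" for i \<omega>
  define B where "B = ln (\<gamma> / w l) + ln (1 / m)"
  define p where "p i = measure ?N (A i)" for i
  have wl: "0 < w l" "w l \<le> 1" using wpos w_le_1 l by auto
  have gw: "1 \<le> \<gamma> / w l" using wl \<gamma> by simp
  have lnm: "0 \<le> ln (1 / m)" using m by simp
  have lng: "0 \<le> ln (\<gamma> / w l)" using gw by simp
  have B: "0 \<le> B" using lnm lng by (simp add: B_def)
  have [measurable]: "A i \<in> sets ?N" for i unfolding A_def by (rule alive_sets[OF D])
  have [measurable]: "Y i \<in> borel_measurable ?N" for i
    unfolding Y_def using k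
    by (intro borel_measurable_ln measurable_compose[OF coordinate_measurable[OF D] bet_measurable]) auto
  have Asp: "A i \<inter> space ?N = A i" for i by (auto simp: A_def alive_def)
  define C where "C = \<bar>ln (1 - l)\<bar> + \<bar>ln (1 / m)\<bar>"
  have x01: "0 \<le> \<omega> i" "\<omega> i \<le> 1" if "\<omega> \<in> space ?N" "1 \<le> i" for \<omega> i
    using space_path_law[OF D that(1)] that(2) by (auto simp: unit_path_def)
  have YC: "\<bar>Y i \<omega>\<bar> \<le> C" and Ym: "Y i \<omega> \<le> ln (1 / m)" if "\<omega> \<in> space ?N" for i \<omega>
    using ln_bet_bound(2,3)[OF m l01 x01[OF that, of "k + i"]] k by (auto simp: Y_def C_def)
  have intI: "integrable ?N (\<lambda>\<omega>. indicator (A i) \<omega> * Y i \<omega>)" for i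
    by (rule integrable_path[OF D, of _ "\<bar>C\<bar>"], measurable)
       (use YC in \<open>auto intro!: abs_indicator_times_le\<close>)
  have step: "b * p i \<le> (LINT \<omega>|?N. indicator (A i) \<omega> * Y i \<omega>)" for i
  proof -
    have "b * p i = (LINT \<omega>|?N. indicator (A i) \<omega> * b)" by (simp add: p_def Asp del: One_nat_def)
    also have "\<dots> \<le> (LINT \<omega>|?N. indicator (A i) \<omega> * Y i \<omega>)"
      unfolding A_def
    proof (rule integral_alive_mono[OF D, where C = "C + b"])
      show "1 \<le> k + i" using k by simp
      fix \<omega> assume w: "\<omega> \<in> space ?N"
      have "0 \<le> C" by (simp add: C_def)
      then show "\<bar>b\<bar> \<le> C + b" "\<bar>Y i \<omega>\<bar> \<le> C + b" using b YC[OF w, of i] by auto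
    next
      fix \<omega> :: "nat \<Rightarrow> real"
      show "(LINT x|D (k + i). b) \<le> (LINT x|D (k + i). Y i (\<omega> (k + i := x)))"
        by (simp add: DQ Q.prob_space Y_def b_def log_growth_def)
    next
      show "(\<lambda>\<omega>. b) \<in> borel_measurable ?N" "Y i \<in> borel_measurable ?N" by measurable
    qed
    finally show ?thesis .
  qed
  \<comment> \<open>Membership in \<open>A N\<close> excludes an alarm up to time
    \<open>k + N - 1\<close>, the last time in the sum, so \<open>M\<close> is still below \<gamma>
    there.\<close>
  have wealth: "(\<Sum>i<N. Y i \<omega>) \<le> ln (\<gamma> / w l)" if wA: "\<omega> \<in> A N" for N \<omega>
  proof (cases N)
    case 0
    then show ?thesis using lng by simp
  next
    case (Suc n)
    have w: "\<omega> \<in> space ?N" and M: "M (k + n) \<omega> < \<gamma>"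
      using wA k Suc by (auto simp: A_def alive_iff)
    have bp: "0 < bet m l (\<omega> i)" if "1 \<le> i" for i
      using bet_bounds(2)[OF m l01 x01[OF w that]] .
    have "(\<Sum>i<N. Y i \<omega>) = ln (\<Prod>i<N. bet m l (\<omega> (k + i)))"
      unfolding Y_def by (intro ln_prod[symmetric]) (use bp k in \<open>auto simp: less_imp_neq[symmetric]\<close>)
    also have "(\<Prod>i<N. bet m l (\<omega> (k + i))) = (\<Prod>i=k..k + n. bet m l (\<omega> i))"
      by (rule prod.reindex_bij_witness[of _ "\<lambda>i. i - k" "\<lambda>i. k + i"]) (auto simp: Suc)
    also have "ln \<dots> \<le> ln (\<gamma> / w l)"
    proof (rule ln_mono)
      show "0 < (\<Prod>i=k..k + n. bet m l (\<omega> i))" using bp k by (intro prod_pos) auto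
      have "w l * (\<Prod>i=k..k + n. bet m l (\<omega> i)) \<le> \<gamma>"
        using prod_le_mix[OF space_path_law[OF D w] l k, of "k + n"] M by simp
      then show "(\<Prod>i=k..k + n. bet m l (\<omega> i)) \<le> \<gamma> / w l"
        using wl by (simp add: field_simps)
    qed
    finally show ?thesis .
  qed
  \<comment> \<open>The last nonzero term belongs to the last draw before which no alarm was raised:
    it is bounded by the overshoot, the earlier terms by \<open>wealth\<close>. Off
    \<open>A 0\<close> both sides are 0.\<close>
  have path: "(\<Sum>i<N. indicator (A i) \<omega> * Y i \<omega>) \<le> indicator (A 0) \<omega> * B" if w: "\<omega> \<in> space ?N" for N \<omega>
  proof (induction N)
    case 0
    then show ?case using B by simp
  next
    case (Suc N)
    show ?case
    proof (cases "\<omega> \<in> A N")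
      case True
      then have A: "\<omega> \<in> A i" if "i \<le> N" for i
        using alive_antimono[of "k + i" "k + N" \<gamma> D] that by (auto simp: A_def)
      then have "(\<Sum>i<Suc N. indicator (A i) \<omega> * Y i \<omega>) = (\<Sum>i<Suc N. Y i \<omega>)"
        by (intro sum.cong) auto
      also have "\<dots> \<le> B" using wealth[OF True] Ym[OF w, of N] by (simp add: B_def)
      finally show ?thesis using A[of 0] by simp
    qed (use Suc in simp)
  qed
  have main: "b * (\<Sum>i<N. p i) \<le> p 0 * B" for N
  proof -
    have "b * (\<Sum>i<N. p i) \<le> (\<Sum>i<N. LINT \<omega>|?N. indicator (A i) \<omega> * Y i \<omega>)"
      unfolding sum_distrib_left by (intro sum_mono step)
    also have "\<dots> = (LINT \<omega>|?N. (\<Sum>i<N. indicator (A i) \<omega> * Y i \<omega>))"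
      by (rule Bochner_Integration.integral_sum[symmetric]) (rule intI)
    also have "\<dots> \<le> (LINT \<omega>|?N. indicator (A 0) \<omega> * B)"
    proof (rule integral_mono)
      show "integrable ?N (\<lambda>\<omega>. \<Sum>i<N. indicator (A i) \<omega> * Y i \<omega>)"
        by (intro Bochner_Integration.integrable_sum intI)
      show "integrable ?N (\<lambda>\<omega>. indicator (A 0) \<omega> * B)"
        by (intro integrable_mult_left integrable_real_indicator) (auto simp: N.emeasure_eq_measure simp del: One_nat_def)
    qed (rule path)
    also have "\<dots> = p 0 * B" by (simp add: p_def Asp del: One_nat_def)
    finally show ?thesis .
  qed
  have p0: "0 \<le> p i" for i by (simp add: p_def)
  have le: "(\<Sum>i<N. p i) \<le> B / b * p 0" for N
    using main[of N] b by (simp add: field_simps)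
  have "(\<integral>\<^sup>+\<omega>. ennreal_of_enat (T_BM m \<Lambda> w \<gamma> \<omega> + 1 - enat k) \<partial>?N) = (\<Sum>i. ennreal (p i))"
    using delay_sum[OF D, of \<gamma> k] by (simp add: p_def A_def)
  also have "\<dots> \<le> ennreal (B / b * p 0)"
  proof (rule suminf_le_const)
    show "(\<Sum>i<N. ennreal (p i)) \<le> ennreal (B / b * p 0)" for N
      using le[of N] p0 by (simp add: sum_ennreal ennreal_leI)
  qed simp
  also have "\<dots> = ennreal (B / b) * emeasure ?N (alive \<gamma> D k)"
  proof -
    have "emeasure ?N (alive \<gamma> D k) = ennreal (p 0)" by (simp only: p_def A_def add_0_right N.emeasure_eq_measure)
    then show ?thesis using B b p0 by (simp only: ennreal_mult divide_nonneg_pos)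
  qed
  finally show ?thesis by (simp add: B_def b_def)
qed

text \<open>The previous bound carries the probability of the conditioning event as a factor;
  dividing it out leaves a constant free of \<open>P\<close> and \<open>k\<close>.\<close>

lemma pollak_delay_upper:
  assumes Q: "Q \<in> unit_probs" and l: "l \<in> \<Lambda>" and pos: "0 < log_growth m Q l" and \<gamma>: "1 \<le> \<gamma>"
  shows "pollak_delay m Q (T_BM m \<Lambda> w \<gamma>) \<le> ennreal ((ln (\<gamma> / w l) + ln (1 / m)) / log_growth m Q l)"
  unfolding pollak_delay_def
proof (rule SUP_least, clarify)
  let ?T = "T_BM m \<Lambda> w \<gamma>"
  fix P and k :: nat
  assume P: "P \<in> pre_laws m" and k: "1 \<le> k"
    and S0: "0 < emeasure (change_law k P Q) {\<omega> \<in> space (change_law k P Q). enat k \<le> ?T \<omega>}"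
  define D where "D i = (if i < k then P else Q)" for i
  have D: "D \<in> path_laws" using P Q by (auto simp: D_def path_laws_def pre_laws_def)
  have N: "change_law k P Q = PiM {1..} D" by (simp add: change_law_def D_def[abs_def])
  have S: "{\<omega> \<in> space (change_law k P Q). enat k \<le> ?T \<omega>} = alive \<gamma> D k" by (simp add: N alive_def)
  let ?N = "PiM {1..} D" and ?B = "ennreal ((ln (\<gamma> / w l) + ln (1 / m)) / log_growth m Q l)"
  interpret N: prob_space ?N by (rule prob_space_path_law[OF D])
  have meas: "(\<lambda>\<omega>. ennreal_of_enat (?T \<omega> + 1 - enat k)) \<in> borel_measurable ?N"
    by (rule measurable_compose[OF T_BM_measurable[OF D]]) simp
  have "(\<integral>\<^sup>+\<omega>. ennreal_of_enat (?T \<omega> + 1 - enat k) * indicator (alive \<gamma> D k) \<omega> \<partial>?N)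
      \<le> (\<integral>\<^sup>+\<omega>. ennreal_of_enat (?T \<omega> + 1 - enat k) \<partial>?N)"
    by (rule nn_integral_mono) (auto split: split_indicator)
  also have "\<dots> \<le> ?B * emeasure ?N (alive \<gamma> D k)"
    by (rule conditional_delay_upper[OF D k _ l pos \<gamma>]) (simp add: D_def)
  finally have "(\<integral>\<^sup>+\<omega>. ennreal_of_enat (?T \<omega> + 1 - enat k) * indicator (alive \<gamma> D k) \<omega> \<partial>?N)
      / emeasure ?N (alive \<gamma> D k) \<le> ?B * emeasure ?N (alive \<gamma> D k) / emeasure ?N (alive \<gamma> D k)"
    by (rule divide_right_mono_ennreal)
  also have "\<dots> = ?B"
    using S0 unfolding S unfolding N by (intro ennreal_mult_divide_eq) (auto simp: N.emeasure_eq_measure simp del: One_nat_def)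
  finally show "(\<integral>\<^sup>+\<omega>. ennreal_of_enat (?T \<omega> + 1 - enat k)
      \<partial>uniform_measure (change_law k P Q) {\<omega> \<in> space (change_law k P Q). enat k \<le> ?T \<omega>}) \<le> ?B"
    unfolding S unfolding N by (subst nn_integral_uniform_measure[OF meas alive_sets[OF D]])
qed

end


text \<open>An intermediate value turns strict bounds by an extended real into weak bounds by a real
  \<open>s\<close>.\<close>

lemma tendsto_one_ennreal:
  fixes f :: "real \<Rightarrow> ennreal"
  assumes upper: "\<And>s. 1 < s \<Longrightarrow> \<forall>\<^sub>F \<gamma> in at_top. f \<gamma> \<le> ennreal s"
    and lower: "\<And>s. 0 < s \<Longrightarrow> s < 1 \<Longrightarrow> \<forall>\<^sub>F \<gamma> in at_top. ennreal s \<le> f \<gamma>"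
  shows "(f \<longlongrightarrow> 1) at_top"
proof (rule order_tendstoI)
  fix a :: ennreal assume "a < 1"
  then obtain x where x: "a < x" "x < 1" using dense by blast
  then obtain s where s: "x = ennreal s" "0 \<le> s" by (cases x) auto
  have "s < 1" using x s by simp
  moreover have "0 < s" using x s by (cases "s = 0") auto
  ultimately have "\<forall>\<^sub>F \<gamma> in at_top. ennreal s \<le> f \<gamma>" by (intro lower)
  then show "\<forall>\<^sub>F \<gamma> in at_top. a < f \<gamma>" by eventually_elim (use x s in auto)
next
  fix a :: ennreal assume "1 < a"
  then obtain x where x: "1 < x" "x < a" using dense by blast
  then obtain s where s: "x = ennreal s" "0 \<le> s" by (cases x) auto
  have "1 < s" using x s by simp
  then have "\<forall>\<^sub>F \<gamma> in at_top. f \<gamma> \<le> ennreal s" by (intro upper)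
  then show "\<forall>\<^sub>F \<gamma> in at_top. f \<gamma> < a" by eventually_elim (use x s in auto)
qed

section \<open>Asymptotics\<close>

locale dense_bet_mixture = bet_mixture +
  assumes dense: "{0<..<1} \<subseteq> closure \<Lambda>"
begin

text \<open>Normalised so that both asymptotic claims become convergence to 1.\<close>

definition ratio :: "real measure \<Rightarrow> real \<Rightarrow> ennreal" where
  "ratio Q \<gamma> = KL_inf Q m * pollak_delay m Q (T_BM m \<Lambda> w \<gamma>) / ennreal (ln \<gamma>)"

lemma eventually_ratio_le:
  assumes \<Delta>: "0 < \<Delta>" "\<Delta> < 1 - m" and s: "1 < s"
  shows "\<forall>\<^sub>F \<gamma> in at_top. \<forall>Q\<in>post_laws (m + \<Delta>). ratio Q \<gamma> \<le> ennreal s"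
proof -
  \<comment> \<open>The tolerance is split as \<open>s = r * r\<close>: one factor absorbs the loss
    in growth rate, the other the constant \<open>B\<close>.\<close>
  define r where "r = sqrt s"
  have r: "1 < r" "r * r = s" using s by (auto simp: r_def)
  define \<kappa> where "\<kappa> = \<Delta>\<^sup>2 / 8"
  have \<kappa>: "0 < \<kappa>" using \<Delta> by (simp add: \<kappa>_def)
  \<comment> \<open>Chosen so that \<open>K - \<delta> \<ge> K / r\<close> for every
    \<open>K \<ge> \<kappa>\<close>: an additive loss becomes a relative one.\<close>
  define \<delta> where "\<delta> = \<kappa> * (1 - 1 / r)"
  have \<delta>: "0 < \<delta>" using \<kappa> r by (simp add: \<delta>_def)
  obtain F where F: "finite F" "F \<subseteq> \<Lambda>"
    and grid: "\<And>Q. Q \<in> post_laws (m + \<Delta>) \<Longrightarrow> \<exists>l\<in>F. enn2real (KL_inf Q m) \<le> log_growth m Q l + \<delta>"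
    using log_growth_grid[OF m \<Delta> dense \<delta>] by blast
  \<comment> \<open>All terms are nonnegative as the weights are at most 1, so the sum bounds the
    cost of whichever stake in \<open>F\<close> is used.\<close>
  define B where "B = (\<Sum>l\<in>F. ln (1 / w l)) + ln (1 / m)"
  have "filterlim ln at_top (at_top :: real filter)" by (rule ln_at_top)
  then have "\<forall>\<^sub>F \<gamma> :: real in at_top. B / (r - 1) \<le> ln \<gamma>" by (simp add: filterlim_at_top)
  then show ?thesis using eventually_gt_at_top[of 1]
  proof eventually_elim
    case (elim \<gamma>)
    have lg: "0 < ln \<gamma>" using elim by simp
    have Bg: "ln \<gamma> + B \<le> r * ln \<gamma>" using elim r by (simp add: field_simps)
    show ?case
    proof
      fix Q assume Q: "Q \<in> post_laws (m + \<Delta>)"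
      then have Qu: "Q \<in> unit_probs" by (simp add: post_laws_def)
      obtain K where K: "KL_inf Q m = ennreal K" "\<kappa> \<le> K"
        using KL_inf_real[OF m \<Delta> Q] unfolding \<kappa>_def by blast
      then have K0: "0 < K" using \<kappa> by simp
      obtain l where l: "l \<in> F" "K \<le> log_growth m Q l + \<delta>" using grid[OF Q] K K0 by auto
      define b where "b = log_growth m Q l"
      have "\<delta> \<le> K * (1 - 1 / r)" unfolding \<delta>_def using K(2) r by (intro mult_right_mono) auto
      then have Kr: "K / r \<le> b" using l by (simp add: b_def algebra_simps)
      have "0 < K / r" using K0 r by simp
      then have b: "0 < b" using Kr by linarith
      have lL: "l \<in> \<Lambda>" using l F by auto
      have wl: "0 < w l" using wpos[OF lL] .
      have "ln (1 / w l) \<le> (\<Sum>l\<in>F. ln (1 / w l))"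
        using F wpos w_le_1 by (intro member_le_sum l(1)) (auto simp: subset_iff)
      then have "ln (\<gamma> / w l) + ln (1 / m) \<le> ln \<gamma> + B"
        using elim wl by (simp add: B_def ln_div)
      then have num: "ln (\<gamma> / w l) + ln (1 / m) \<le> r * ln \<gamma>" using Bg by linarith
      have "K * ((ln (\<gamma> / w l) + ln (1 / m)) / b) \<le> K * (r * ln \<gamma> / b)"
        using num b K0 by (intro mult_left_mono divide_right_mono) auto
      also have "\<dots> \<le> K * (r * ln \<gamma> / (K / r))"
        using Kr b K0 r lg by (intro mult_left_mono divide_left_mono) auto
      also have "\<dots> = s * ln \<gamma>" using K0 r by (simp flip: r(2))
      finally have le: "K * ((ln (\<gamma> / w l) + ln (1 / m)) / b) \<le> s * ln \<gamma>" .
      have "KL_inf Q m * pollak_delay m Q (T_BM m \<Lambda> w \<gamma>)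
          \<le> ennreal K * ennreal ((ln (\<gamma> / w l) + ln (1 / m)) / b)"
        unfolding K(1) b_def
        using pollak_delay_upper[OF Qu lL, of \<gamma>] b elim by (intro mult_left_mono) (auto simp: b_def)
      also have "\<dots> = ennreal (K * ((ln (\<gamma> / w l) + ln (1 / m)) / b))"
        by (rule ennreal_mult'[symmetric]) (use K0 in simp)
      also have "\<dots> \<le> ennreal (s * ln \<gamma>)" using le by (rule ennreal_leI)
      finally have "ratio Q \<gamma> \<le> ennreal (s * ln \<gamma>) / ennreal (ln \<gamma>)"
        unfolding ratio_def by (rule divide_right_mono_ennreal)
      also have "\<dots> = ennreal s" using s lg by (subst divide_ennreal) auto
      finally show "ratio Q \<gamma> \<le> ennreal s" .
    qed
  qed
qed

lemma eventually_ratio_ge: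
  assumes \<Delta>: "0 < \<Delta>" "\<Delta> < 1 - m" and Q: "Q \<in> post_laws (m + \<Delta>)" and s: "0 < s" "s < 1"
  shows "\<forall>\<^sub>F \<gamma> in at_top. ennreal s \<le> ratio Q \<gamma>"
proof -
  have Qu: "Q \<in> unit_probs" using Q by (simp add: post_laws_def)
  obtain K where K: "KL_inf Q m = ennreal K" "\<Delta>\<^sup>2 / 8 \<le> K" using KL_inf_real[OF m \<Delta> Q] by blast
  have "0 < \<Delta>\<^sup>2 / 8" using \<Delta> by simp
  then have K0: "0 < K" using K by linarith
  define r where "r = sqrt s"
  have r: "0 < r" "r < 1" "r * r = s" using s by (auto simp: r_def)
  \<comment> \<open>The solution of \<open>K + 1 / c = K / r\<close>; the second factor
    \<open>r\<close> of \<open>s\<close> absorbs \<open>ln c\<close>.\<close>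
  define c where "c = r / (K * (1 - r))"
  have c: "0 < c" using r K0 by (simp add: c_def)
  have Kc: "K + 1 / c = K / r" using r K0 by (simp add: c_def field_simps)
  have "\<forall>\<^sub>F \<gamma> :: real in at_top. ln c / (1 - r) \<le> ln \<gamma>"
    using ln_at_top by (simp add: filterlim_at_top)
  then show ?thesis using eventually_gt_at_top[of 1]
  proof eventually_elim
    case (elim \<gamma>)
    let ?C = "pollak_delay m Q (T_BM m \<Lambda> w \<gamma>)"
    have lg: "0 < ln \<gamma>" using elim by simp
    have "r * ln \<gamma> \<le> ln \<gamma> - ln c" using elim r by (simp add: field_simps)
    also have "\<dots> \<le> ln (c + \<gamma>) - ln c" using c elim by simp
    finally have "ennreal (r * ln \<gamma>) \<le> ennreal (ln (c + \<gamma>) - ln c)" by (rule ennreal_leI)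
    also have "\<dots> \<le> ennreal (K / r) * (\<integral>\<^sup>+\<omega>. ennreal_of_enat (T_BM m \<Lambda> w \<gamma> \<omega>) \<partial>iid_law Q)"
      unfolding Kc[symmetric] using K0 elim by (intro iid_delay_lower Qu K(1) c) auto
    also have "\<dots> \<le> ennreal (K / r) * ?C"
      by (intro mult_left_mono iid_delay_le_pollak Qu) simp
    finally have "ennreal r * ennreal (r * ln \<gamma>) \<le> ennreal r * (ennreal (K / r) * ?C)"
      by (rule mult_left_mono) (rule zero_le)
    also have "\<dots> = KL_inf Q m * ?C"
      unfolding K(1) mult.assoc[symmetric] using r K0 by (subst ennreal_mult[symmetric]) auto
    also have "ennreal r * ennreal (r * ln \<gamma>) = ennreal (s * ln \<gamma>)"
      using r lg by (subst ennreal_mult[symmetric]) (auto simp: mult.assoc[symmetric])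
    finally have "ennreal (s * ln \<gamma>) / ennreal (ln \<gamma>) \<le> ratio Q \<gamma>"
      unfolding ratio_def by (rule divide_right_mono_ennreal)
    moreover have "ennreal (s * ln \<gamma>) / ennreal (ln \<gamma>) = ennreal s"
      using s lg by (subst divide_ennreal) auto
    ultimately show ?case by simp
  qed
qed

lemma ratio_tendsto:
  assumes \<Delta>: "0 < \<Delta>" "\<Delta> < 1 - m" and Q: "Q \<in> post_laws (m + \<Delta>)"
  shows "(ratio Q \<longlongrightarrow> 1) at_top"
proof (rule tendsto_one_ennreal)
  show "\<forall>\<^sub>F \<gamma> in at_top. ratio Q \<gamma> \<le> ennreal s" if "1 < s" for s
    using eventually_ratio_le[OF \<Delta> that] by eventually_elim (use Q in auto)
qed (rule eventually_ratio_ge[OF \<Delta> Q])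

text \<open>Half of the excess of the mean over \<open>m\<close> serves as gap, so a single law
  falls under the uniform estimates.\<close>

lemma post_laws_gap:
  assumes "Q \<in> post_laws m"
  obtains \<Delta> where "0 < \<Delta>" "\<Delta> < 1 - m" "Q \<in> post_laws (m + \<Delta>)"
proof -
  have Q: "Q \<in> unit_probs" and mean: "m < (LINT x|Q. x)" using assms by (auto simp: post_laws_def)
  interpret Q: prob_space Q by (rule unit_probsD[OF Q])
  have "(LINT x|Q. x) \<le> (LINT x|Q. 1)"
    by (rule integral_mono_unit[OF Q integrable_id_unit[OF Q]]) auto
  then have "(LINT x|Q. x) \<le> 1" by (simp add: Q.prob_space)
  then show thesis
    using mean m Q by (intro that[of "((LINT x|Q. x) - m) / 2"]) (auto simp: post_laws_def field_simps)
qed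

lemma delay_tendsto:
  assumes Q: "Q \<in> post_laws m"
  shows "((\<lambda>\<gamma>. pollak_delay m Q (T_BM m \<Lambda> w \<gamma>) / ennreal (ln \<gamma>)) \<longlongrightarrow> 1 / KL_inf Q m) at_top"
proof -
  obtain \<Delta> where \<Delta>: "0 < \<Delta>" "\<Delta> < 1 - m" and Q': "Q \<in> post_laws (m + \<Delta>)"
    using post_laws_gap[OF Q] by blast
  obtain K where K: "KL_inf Q m = ennreal K" "\<Delta>\<^sup>2 / 8 \<le> K" using KL_inf_real[OF m \<Delta> Q'] by blast
  have "0 < \<Delta>\<^sup>2 / 8" using \<Delta> by simp
  then have K0: "0 < K" using K by linarith
  have one: "ennreal (1 / K) * ennreal K = 1"
    using K0 by (subst ennreal_mult[symmetric]) auto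
  have eq: "ennreal (1 / K) * ratio Q \<gamma> = pollak_delay m Q (T_BM m \<Lambda> w \<gamma>) / ennreal (ln \<gamma>)" for \<gamma>
    unfolding ratio_def K(1) ennreal_times_divide mult.assoc[symmetric] one by simp
  have "((\<lambda>\<gamma>. ennreal (1 / K) * ratio Q \<gamma>) \<longlongrightarrow> ennreal (1 / K) * 1) at_top"
    by (rule ennreal_tendsto_cmult[OF _ ratio_tendsto[OF \<Delta> Q']]) simp
  moreover have "ennreal (1 / K) * 1 = 1 / KL_inf Q m"
    unfolding K(1) using divide_ennreal[of 1 K] K0 by simp
  ultimately show ?thesis unfolding eq by simp
qed

text \<open>The upper bound is already uniform in \<open>Q\<close>. For the lower bound one member
  of the class is enough, here the point mass at 1.\<close>

lemma worst_case_tendsto: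
  assumes \<Delta>: "0 < \<Delta>" "\<Delta> < 1 - m"
  shows "((\<lambda>\<gamma>. SUP Q \<in> post_laws (m + \<Delta>). ratio Q \<gamma>) \<longlongrightarrow> 1) at_top"
proof (rule tendsto_one_ennreal)
  show "\<forall>\<^sub>F \<gamma> in at_top. (SUP Q \<in> post_laws (m + \<Delta>). ratio Q \<gamma>) \<le> ennreal s" if "1 < s" for s
    using eventually_ratio_le[OF \<Delta> that] by eventually_elim (auto intro: SUP_least)
  have Q: "return unit_borel 1 \<in> post_laws (m + \<Delta>)"
    using return_unit[of 1] \<Delta> by (simp add: post_laws_def)
  show "\<forall>\<^sub>F \<gamma> in at_top. ennreal s \<le> (SUP Q \<in> post_laws (m + \<Delta>). ratio Q \<gamma>)" if "0 < s" "s < 1" for s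
    using eventually_ratio_ge[OF \<Delta> Q that] by eventually_elim (rule SUP_upper2[OF Q])
qed

end

theorem theorem8:
  fixes m :: real and \<Lambda> :: "real set" and w :: "real \<Rightarrow> real"
  assumes "0 < m" and "m < 1"
    and "\<Lambda> \<subseteq> {0<..<1}" and "countable \<Lambda>" and "{0<..<1} \<subseteq> closure \<Lambda>"
    and "\<And>l. l \<in> \<Lambda> \<Longrightarrow> w l > 0" and "(w has_sum 1) \<Lambda>"
  shows "(\<forall>\<gamma>>0. (INF P \<in> pre_laws m. \<integral>\<^sup>+ \<omega>. ennreal_of_enat (T_BM m \<Lambda> w \<gamma> \<omega>) \<partial>iid_law P)
            \<ge> ennreal \<gamma>) \<and>
         (\<forall>Q \<in> post_laws m.
            ((\<lambda>\<gamma>. pollak_delay m Q (T_BM m \<Lambda> w \<gamma>) / ennreal (ln \<gamma>))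
               \<longlongrightarrow> 1 / KL_inf Q m) at_top) \<and>
         (\<forall>\<Delta> \<in> {0<..<1 - m}.
            ((\<lambda>\<gamma>. SUP Q \<in> post_laws (m + \<Delta>).
                 KL_inf Q m * pollak_delay m Q (T_BM m \<Lambda> w \<gamma>) / ennreal (ln \<gamma>))
               \<longlongrightarrow> 1) at_top)"
proof -
  interpret dense_bet_mixture m \<Lambda> w
    by unfold_locales (use assms in auto)
  show ?thesis
  proof (intro conjI ballI allI impI)
    fix \<gamma> :: real assume "0 < \<gamma>"
    then show "ennreal \<gamma> \<le> (INF P \<in> pre_laws m. \<integral>\<^sup>+ \<omega>. ennreal_of_enat (T_BM m \<Lambda> w \<gamma> \<omega>) \<partial>iid_law P)"
      by (intro INF_greatest run_length_bound)
  next
    fix \<Delta> assume "\<Delta> \<in> {0<..<1 - m}"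
    then show "((\<lambda>\<gamma>. SUP Q \<in> post_laws (m + \<Delta>).
        KL_inf Q m * pollak_delay m Q (T_BM m \<Lambda> w \<gamma>) / ennreal (ln \<gamma>)) \<longlongrightarrow> 1) at_top"
      using worst_case_tendsto[of \<Delta>] by (simp add: ratio_def)
  qed (rule delay_tendsto)
qed

end
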